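(* Let $K$ be an algebraically closed field of characteristic zero, let $\mathfrak{g}$ be a finite dimensional nonabelian Lie algebra over $K$, let $U = U(\mathfrak{g})$, and let $H = H(\mathfrak{g})$ be the homogenized enveloping algebra of $\mathfrak{g}$. Let $X = X' \oplus K \subseteq U_1 = \mathfrak{g} \oplus K$, where $X'$ is the set of elements $x' \in \mathfrak{g}$ such that $\mathrm{ad}\, x'$ is not nilpotent if $\mathfrak{g}$ is not nilpotent, and $X' = \mathfrak{g} \setminus \mathfrak{z}$, with $\mathfrak{z}$ the center of $\mathfrak{g}$, if $\mathfrak{g}$ is nilpotent. Let $\widetilde{X} = Xz = \{xz : x \in X\} \subseteq H(1)$. Then the left $H$-module $H/HL$ is faithful for all $L \in \widetilde{X}$.
   Context: The standard filtration on $U = U(\mathfrak{g})$ is $U_0 = K$, $U_1 = \mathfrak{g} \oplus K$, $U_n = U_1^n$ for $n \ge 2$. The homogenized enveloping algebra $H(\mathfrak{g})$ is the Rees ring of this filtration, i.e. the graded subring $H(\mathfrak{g}) = \bigoplus_{n\ge 0} U_n z^n$ of the polynomial ring $U[z]$ ($z$ a central indeterminate), with $H(n) = U_n z^n$; thus $H(1) = Kz \oplus \mathfrak{g}z$. The set $X = X' \oplus K$ means $\{x' + \mu : x' \in X', \mu \in K\}$; it is a nonempty Zariski open subset of $U_1$. A left module is faithful if its annihilator is zero. *)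

theory Defs
  imports "HOL-Algebra.Algebra" "HOL-Algebra.Algebraic_Closure_Type" "HOL-Library.Poly_Mapping"
begin

section \<open>Lie algebras\<close>

text \<open>
  The underlying vector space is a type \<open>'g\<close> with a scalar multiplication by the field \<open>'k\<close>;
  finite dimensionality is expressed separately by the library locale
  \<^locale>\<open>finite_dimensional_vector_space\<close>.
\<close>

locale lie_algebra = vector_space scale
  for scale :: "'k::field \<Rightarrow> 'g::ab_group_add \<Rightarrow> 'g" +
  fixes br :: "'g \<Rightarrow> 'g \<Rightarrow> 'g"
  assumes br_add_left: "br (x + y) z = br x z + br y z"
    and br_add_right: "br x (y + z) = br x y + br x z"
    and br_scale_left: "br (scale c x) y = scale c (br x y)"
    and br_scale_right: "br x (scale c y) = scale c (br x y)"
    and br_self: "br x x = 0"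
    and jacobi: "br x (br y z) + br y (br z x) + br z (br x y) = 0"

definition lie_abelian :: "('g::zero \<Rightarrow> 'g \<Rightarrow> 'g) \<Rightarrow> bool"
  where "lie_abelian br \<longleftrightarrow> (\<forall>x y. br x y = 0)"

definition lie_center :: "('g::zero \<Rightarrow> 'g \<Rightarrow> 'g) \<Rightarrow> 'g set"
  where "lie_center br = {x. \<forall>y. br x y = 0}"

fun lower_central_series ::
    "('k::field \<Rightarrow> 'g::ab_group_add \<Rightarrow> 'g) \<Rightarrow> ('g \<Rightarrow> 'g \<Rightarrow> 'g) \<Rightarrow> nat \<Rightarrow> 'g set"
  where
    "lower_central_series scale br 0 = UNIV"
  | "lower_central_series scale br (Suc n) =
       Modules.module.span scale {br x y | x y. y \<in> lower_central_series scale br n}"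

definition lie_nilpotent ::
    "('k::field \<Rightarrow> 'g::ab_group_add \<Rightarrow> 'g) \<Rightarrow> ('g \<Rightarrow> 'g \<Rightarrow> 'g) \<Rightarrow> bool"
  where "lie_nilpotent scale br \<longleftrightarrow> (\<exists>n. lower_central_series scale br n = {0})"

definition ad_nilpotent :: "('g::zero \<Rightarrow> 'g \<Rightarrow> 'g) \<Rightarrow> 'g \<Rightarrow> bool"
  where "ad_nilpotent br x \<longleftrightarrow> (\<exists>n. \<forall>y. (br x ^^ n) y = 0)"

definition X_prime ::
    "('k::field \<Rightarrow> 'g::ab_group_add \<Rightarrow> 'g) \<Rightarrow> ('g \<Rightarrow> 'g \<Rightarrow> 'g) \<Rightarrow> 'g set"
  where "X_prime scale br =
    (if lie_nilpotent scale br then UNIV - lie_center br else {x. \<not> ad_nilpotent br x})"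


section \<open>The universal enveloping algebra\<close>

text \<open>
  Words under concatenation form a monoid, written additively so that the convolution product
  of \<^theory>\<open>HOL-Library.Poly_Mapping\<close> makes \<open>'g list \<Rightarrow>\<^sub>0 'k\<close> the free associative
  unital \<open>'k\<close>-algebra on the \<^emph>\<open>set\<close> of elements of \<open>'g\<close>.
\<close>

instantiation list :: (type) monoid_add
begin
definition zero_list :: "'a list" where "0 = []"
definition plus_list :: "'a list \<Rightarrow> 'a list \<Rightarrow> 'a list" where "xs + ys = xs @ ys"
instance by standard (simp_all add: zero_list_def plus_list_def)
end

abbreviation free_algebra :: "('g list \<Rightarrow>\<^sub>0 'k::field) ring"
  where "free_algebra \<equiv> ring_of_type_algebra"

definition gen :: "'g \<Rightarrow> 'g list \<Rightarrow>\<^sub>0 'k::field"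
  where "gen x = Poly_Mapping.single [x] 1"

definition scalar :: "'k \<Rightarrow> 'g list \<Rightarrow>\<^sub>0 'k::field"
  where "scalar c = Poly_Mapping.single [] c"

text \<open>
  The first two families of relations cut the free algebra on the set \<open>'g\<close> down to the tensor
  algebra of the vector space \<open>'g\<close>; the third one then gives the enveloping algebra.
\<close>

definition enveloping_relations ::
    "('k::field \<Rightarrow> 'g::ab_group_add \<Rightarrow> 'g) \<Rightarrow> ('g \<Rightarrow> 'g \<Rightarrow> 'g) \<Rightarrow> ('g list \<Rightarrow>\<^sub>0 'k) set"
  where "enveloping_relations scale br =
      {gen (x + y) - (gen x + gen y) | x y. True}
    \<union> {gen (scale c x) - scalar c * gen x | c x. True}
    \<union> {gen x * gen y - gen y * gen x - gen (br x y) | x y. True}"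

definition enveloping_ideal ::
    "('k::field \<Rightarrow> 'g::ab_group_add \<Rightarrow> 'g) \<Rightarrow> ('g \<Rightarrow> 'g \<Rightarrow> 'g) \<Rightarrow> ('g list \<Rightarrow>\<^sub>0 'k) set"
  where "enveloping_ideal scale br = Idl\<^bsub>free_algebra\<^esub> (enveloping_relations scale br)"

definition enveloping_algebra ::
    "('k::field \<Rightarrow> 'g::ab_group_add \<Rightarrow> 'g) \<Rightarrow> ('g \<Rightarrow> 'g \<Rightarrow> 'g) \<Rightarrow> ('g list \<Rightarrow>\<^sub>0 'k) set ring"
  where "enveloping_algebra scale br = free_algebra Quot (enveloping_ideal scale br)"

definition env_proj ::
    "('k::field \<Rightarrow> 'g::ab_group_add \<Rightarrow> 'g) \<Rightarrow> ('g \<Rightarrow> 'g \<Rightarrow> 'g) \<Rightarrow>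
      ('g list \<Rightarrow>\<^sub>0 'k) \<Rightarrow> ('g list \<Rightarrow>\<^sub>0 'k) set"
  where "env_proj scale br p = enveloping_ideal scale br +>\<^bsub>free_algebra\<^esub> p"

definition env_embed ::
    "('k::field \<Rightarrow> 'g::ab_group_add \<Rightarrow> 'g) \<Rightarrow> ('g \<Rightarrow> 'g \<Rightarrow> 'g) \<Rightarrow> 'g \<Rightarrow> ('g list \<Rightarrow>\<^sub>0 'k) set"
  where "env_embed scale br x = env_proj scale br (gen x)"

definition env_scalar ::
    "('k::field \<Rightarrow> 'g::ab_group_add \<Rightarrow> 'g) \<Rightarrow> ('g \<Rightarrow> 'g \<Rightarrow> 'g) \<Rightarrow> 'k \<Rightarrow> ('g list \<Rightarrow>\<^sub>0 'k) set"
  where "env_scalar scale br c = env_proj scale br (scalar c)"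

lemma ring_free_algebra: "ring (free_algebra :: ('g list \<Rightarrow>\<^sub>0 'k::field) ring)"
proof -
  have "\<exists>y. y + x = 0 \<and> x + y = 0" for x :: "'g list \<Rightarrow>\<^sub>0 'k"
    by (rule exI[of _ "- x"]) simp
  then show ?thesis
    unfolding ring_of_type_algebra_def
    by unfold_locales (auto simp: algebra_simps Units_def)
qed

lemma ideal_enveloping_ideal: "ideal (enveloping_ideal scale br) free_algebra"
  unfolding enveloping_ideal_def
  by (rule ring.genideal_ideal[OF ring_free_algebra]) (simp add: ring_of_type_algebra_def)

lemma enveloping_relations_subset: "enveloping_relations scale br \<subseteq> enveloping_ideal scale br"
  unfolding enveloping_ideal_def
  by (rule ring.genideal_self[OF ring_free_algebra]) (simp add: ring_of_type_algebra_def)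

lemma ring_enveloping_algebra: "ring (enveloping_algebra scale br)"
  unfolding enveloping_algebra_def by (rule ideal.quotient_is_ring[OF ideal_enveloping_ideal])

lemma minus_free_algebra: "a \<ominus>\<^bsub>free_algebra\<^esub> b = a - b"
  for a b :: "'g list \<Rightarrow>\<^sub>0 'k::field"
proof -
  interpret F: ring "free_algebra :: ('g list \<Rightarrow>\<^sub>0 'k) ring" by (rule ring_free_algebra)
  have "\<ominus>\<^bsub>free_algebra\<^esub> b = - b"
    by (rule F.minus_equality) (auto simp: ring_of_type_algebra_def)
  then show ?thesis by (simp add: a_minus_def ring_of_type_algebra_def)
qed

lemma
  shows env_proj_add: "env_proj scale br p \<oplus>\<^bsub>enveloping_algebra scale br\<^esub> env_proj scale br q
      = env_proj scale br (p + q)"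
    and env_proj_mult: "env_proj scale br p \<otimes>\<^bsub>enveloping_algebra scale br\<^esub> env_proj scale br q
      = env_proj scale br (p * q)"
    and env_proj_one: "\<one>\<^bsub>enveloping_algebra scale br\<^esub> = env_proj scale br 1"
    and env_proj_zero: "\<zero>\<^bsub>enveloping_algebra scale br\<^esub> = env_proj scale br 0"
    and env_proj_minus: "\<ominus>\<^bsub>enveloping_algebra scale br\<^esub> env_proj scale br p = env_proj scale br (- p)"
    and carrier_enveloping_algebra: "carrier (enveloping_algebra scale br) = range (env_proj scale br)"
proof -
  interpret I: ideal "enveloping_ideal scale br" free_algebra by (rule ideal_enveloping_ideal)
  interpret U: ring "enveloping_algebra scale br" by (rule ring_enveloping_algebra)
  have hom: "ring_hom_ring free_algebra (enveloping_algebra scale br) (env_proj scale br)"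
    using I.rcos_ring_hom_ring unfolding enveloping_algebra_def env_proj_def .
  interpret h: ring_hom_ring free_algebra "enveloping_algebra scale br" "env_proj scale br" by (rule hom)
  note F = ring_of_type_algebra_def
  show add: "env_proj scale br p \<oplus>\<^bsub>enveloping_algebra scale br\<^esub> env_proj scale br q
      = env_proj scale br (p + q)" for p q
    using h.hom_add[of p q] by (simp add: F)
  show "env_proj scale br p \<otimes>\<^bsub>enveloping_algebra scale br\<^esub> env_proj scale br q
      = env_proj scale br (p * q)"
    using h.hom_mult[of p q] by (simp add: F)
  show "\<one>\<^bsub>enveloping_algebra scale br\<^esub> = env_proj scale br 1"
    using h.hom_one by (simp add: F)
  show zero: "\<zero>\<^bsub>enveloping_algebra scale br\<^esub> = env_proj scale br 0"
    using h.hom_zero by (simp add: F)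
  show car: "carrier (enveloping_algebra scale br) = range (env_proj scale br)"
    by (auto simp: enveloping_algebra_def FactRing_def A_RCOSETS_def' env_proj_def F)
  show "\<ominus>\<^bsub>enveloping_algebra scale br\<^esub> env_proj scale br p = env_proj scale br (- p)"
    by (rule U.minus_equality) (auto simp: add zero car)
qed

lemma env_proj_eq_iff: "env_proj scale br p = env_proj scale br q \<longleftrightarrow> p - q \<in> enveloping_ideal scale br"
proof -
  interpret I: ideal "enveloping_ideal scale br" free_algebra by (rule ideal_enveloping_ideal)
  show ?thesis unfolding env_proj_def
    using I.quotient_eq_iff_same_a_r_cos[OF ideal_enveloping_ideal, of p q]
    by (simp add: minus_free_algebra) (simp add: ring_of_type_algebra_def)
qed

lemma env_embed_add:
  "env_embed scale br (x + y) =
     env_embed scale br x \<oplus>\<^bsub>enveloping_algebra scale br\<^esub> env_embed scale br y"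
proof -
  have "gen (x + y) - (gen x + gen y) \<in> enveloping_ideal scale br"
    using enveloping_relations_subset[of scale br] unfolding enveloping_relations_def by blast
  then show ?thesis
    unfolding env_embed_def env_proj_add env_proj_eq_iff .
qed

lemma env_embed_scale:
  "env_embed scale br (scale c x) =
     env_scalar scale br c \<otimes>\<^bsub>enveloping_algebra scale br\<^esub> env_embed scale br x"
proof -
  have "gen (scale c x) - scalar c * gen x \<in> enveloping_ideal scale br"
    using enveloping_relations_subset[of scale br] unfolding enveloping_relations_def by blast
  then show ?thesis
    unfolding env_embed_def env_scalar_def env_proj_mult env_proj_eq_iff .
qed

lemma env_embed_br:
  "env_embed scale br (br x y) =
     env_embed scale br x \<otimes>\<^bsub>enveloping_algebra scale br\<^esub> env_embed scale br y
     \<ominus>\<^bsub>enveloping_algebra scale br\<^esub>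
     env_embed scale br y \<otimes>\<^bsub>enveloping_algebra scale br\<^esub> env_embed scale br x"
proof -
  interpret I: ideal "enveloping_ideal scale br" free_algebra by (rule ideal_enveloping_ideal)
  have "gen x * gen y - gen y * gen x - gen (br x y) \<in> enveloping_ideal scale br"
    using enveloping_relations_subset[of scale br] unfolding enveloping_relations_def by blast
  then show ?thesis
    unfolding env_embed_def a_minus_def env_proj_mult env_proj_minus env_proj_add
    by (metis env_proj_eq_iff diff_conv_add_uminus)
qed

definition plus_scalars ::
    "('k::field \<Rightarrow> 'g::ab_group_add \<Rightarrow> 'g) \<Rightarrow> ('g \<Rightarrow> 'g \<Rightarrow> 'g) \<Rightarrow> 'g set \<Rightarrow> ('g list \<Rightarrow>\<^sub>0 'k) set set"
  where "plus_scalars scale br S =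
    {env_embed scale br x \<oplus>\<^bsub>enveloping_algebra scale br\<^esub> env_scalar scale br \<mu> | x \<mu>. x \<in> S}"

text \<open>
  \<^const>\<open>ideal_prod\<close> forms the set of all nonempty finite sums of products, which for linear
  subspaces of \<open>U\<close> is their product subspace; thus \<open>U\<^sub>n\<close> is the \<open>n\<close>-th power of \<open>U\<^sub>1\<close>.
\<close>

fun std_filtration ::
    "('k::field \<Rightarrow> 'g::ab_group_add \<Rightarrow> 'g) \<Rightarrow> ('g \<Rightarrow> 'g \<Rightarrow> 'g) \<Rightarrow> nat \<Rightarrow> ('g list \<Rightarrow>\<^sub>0 'k) set set"
  where
    "std_filtration scale br 0 = range (env_scalar scale br)"
  | "std_filtration scale br (Suc 0) = plus_scalars scale br UNIV"
  | "std_filtration scale br (Suc (Suc n)) =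
       ideal_prod (enveloping_algebra scale br)
         (std_filtration scale br (Suc 0)) (std_filtration scale br (Suc n))"

lemma std_filtration_subset: "std_filtration scale br n \<subseteq> carrier (enveloping_algebra scale br)"
proof (induction scale br n rule: std_filtration.induct)
  case (1 scale br)
  then show ?case by (auto simp: env_scalar_def carrier_enveloping_algebra)
next
  case (2 scale br)
  then show ?case
    by (auto simp: plus_scalars_def env_scalar_def env_embed_def env_proj_add carrier_enveloping_algebra)
next
  case (3 scale br n)
  interpret U: ring "enveloping_algebra scale br" by (rule ring_enveloping_algebra)
  have "u \<in> carrier (enveloping_algebra scale br)"
    if "u \<in> ideal_prod (enveloping_algebra scale br)
         (std_filtration scale br (Suc 0)) (std_filtration scale br (Suc n))" for u
    using that by (induction rule: ideal_prod.induct) (use 3 in auto)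
  then show ?case by auto
qed

lemma scalar_simps:
  "scalar 0 = 0" "scalar 1 = 1" "scalar (a + b) = scalar a + scalar b"
  "scalar (a * b) = scalar a * scalar b" "scalar (- a) = - scalar a"
  for a b :: "'k::field"
  by (simp_all add: scalar_def single_add mult_single single_uminus flip: zero_list_def)

lemma scalar_mult_commute: "scalar c * p = p * scalar c"
  for p :: "'g list \<Rightarrow>\<^sub>0 'k::field"
proof (induction p rule: Poly_Mapping.update_induct)
  case (update p w d)
  have "Poly_Mapping.update w d p = p + Poly_Mapping.single w d"
    using update(1) by (intro poly_mapping_eqI)
      (auto simp: lookup_update lookup_add lookup_single in_keys_iff when_def)
  moreover have "scalar c * Poly_Mapping.single w d = Poly_Mapping.single w d * scalar c"
    by (simp add: scalar_def mult_single mult.commute flip: zero_list_def)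
  ultimately show ?case
    using update(3) by (simp add: distrib_left distrib_right)
qed simp

context lie_algebra
begin

lemma plus_scalars_UNIV: "plus_scalars scale br UNIV =
  {env_proj scale br (gen x + scalar c) | x c. True}"
  by (auto simp: plus_scalars_def env_embed_def env_scalar_def env_proj_add)

lemma env_proj_gen_add: "env_proj scale br (gen (x + y)) = env_proj scale br (gen x + gen y)"
  using env_embed_add[of scale br x y] by (simp add: env_embed_def env_proj_add)

lemma env_proj_gen_scale: "env_proj scale br (gen (scale c x)) = env_proj scale br (scalar c * gen x)"
  using env_embed_scale[of scale br c x] by (simp add: env_embed_def env_scalar_def env_proj_mult)

lemma std_filtration_add:
  assumes "u \<in> std_filtration scale br n" "v \<in> std_filtration scale br n"
  shows "u \<oplus>\<^bsub>enveloping_algebra scale br\<^esub> v \<in> std_filtration scale br n"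
proof -
  consider "n = 0" | "n = Suc 0" | m where "n = Suc (Suc m)"
    by (metis not0_implies_Suc)
  then show ?thesis
  proof cases
    case 1
    then show ?thesis using assms
      by (auto simp: env_scalar_def env_proj_add simp flip: scalar_simps)
  next
    case 2
    then obtain x c y d where u: "u = env_proj scale br (gen x + scalar c)"
      and v: "v = env_proj scale br (gen y + scalar d)"
      using assms by (auto simp: plus_scalars_UNIV)
    have "u \<oplus>\<^bsub>enveloping_algebra scale br\<^esub> v
        = env_proj scale br (gen x + gen y) \<oplus>\<^bsub>enveloping_algebra scale br\<^esub> env_proj scale br (scalar (c + d))"
      unfolding u v env_proj_add by (simp add: scalar_simps algebra_simps)
    also have "\<dots> = env_proj scale br (gen (x + y) + scalar (c + d))"
      by (simp add: env_proj_gen_add[symmetric] env_proj_add)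
    finally show ?thesis using 2 by (auto simp: plus_scalars_UNIV)
  next
    case 3
    then show ?thesis using assms by (auto intro: ideal_prod.sum)
  qed
qed

lemma std_filtration_scalar:
  assumes "u \<in> std_filtration scale br n"
  shows "env_proj scale br (scalar c) \<otimes>\<^bsub>enveloping_algebra scale br\<^esub> u \<in> std_filtration scale br n"
proof -
  interpret U: ring "enveloping_algebra scale br" by (rule ring_enveloping_algebra)
  have 1: "env_proj scale br (scalar c) \<otimes>\<^bsub>enveloping_algebra scale br\<^esub> u \<in> std_filtration scale br (Suc 0)"
    if "u \<in> std_filtration scale br (Suc 0)" for u
  proof -
    from that obtain x d where u: "u = env_proj scale br (gen x + scalar d)"
      by (auto simp: plus_scalars_UNIV)
    have "env_proj scale br (scalar c) \<otimes>\<^bsub>enveloping_algebra scale br\<^esub> u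
        = env_proj scale br (scalar c * gen x) \<oplus>\<^bsub>enveloping_algebra scale br\<^esub> env_proj scale br (scalar (c * d))"
      unfolding u env_proj_mult env_proj_add by (simp add: scalar_simps algebra_simps)
    also have "\<dots> = env_proj scale br (gen (scale c x) + scalar (c * d))"
      by (simp add: env_proj_gen_scale[symmetric] env_proj_add)
    finally show ?thesis by (auto simp: plus_scalars_UNIV)
  qed
  consider "n = 0" | "n = Suc 0" | m where "n = Suc (Suc m)"
    by (metis not0_implies_Suc)
  then show ?thesis
  proof cases
    case 1
    then show ?thesis using assms
      by (auto simp: env_scalar_def env_proj_mult simp flip: scalar_simps)
  next
    case 2
    then show ?thesis using 1 assms by simp
  next
    case (3 m)
    have c: "env_proj scale br (scalar c) \<in> carrier (enveloping_algebra scale br)"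
      by (simp add: carrier_enveloping_algebra)
    from assms[unfolded 3 std_filtration.simps(3)] have
      "env_proj scale br (scalar c) \<otimes>\<^bsub>enveloping_algebra scale br\<^esub> u
        \<in> ideal_prod (enveloping_algebra scale br) (std_filtration scale br (Suc 0)) (std_filtration scale br (Suc m))
       \<and> u \<in> carrier (enveloping_algebra scale br)"
    proof (induction rule: ideal_prod.induct)
      case (prod i j)
      then have ij: "i \<in> carrier (enveloping_algebra scale br)" "j \<in> carrier (enveloping_algebra scale br)"
        using std_filtration_subset by blast+
      show ?case
        using ideal_prod.prod[OF 1[OF prod(1)] prod(2), of "enveloping_algebra scale br"] ij c
        by (simp add: U.m_assoc)
    next
      case (sum s1 s2)
      then show ?case using c by (auto simp: U.r_distr intro: ideal_prod.sum)
    qed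
    then show ?thesis using 3 by simp
  qed
qed

lemma std_filtration_minus:
  assumes "u \<in> std_filtration scale br n"
  shows "\<ominus>\<^bsub>enveloping_algebra scale br\<^esub> u \<in> std_filtration scale br n"
proof -
  obtain p where u: "u = env_proj scale br p"
    using assms std_filtration_subset carrier_enveloping_algebra by blast
  show ?thesis
    using std_filtration_scalar[OF assms, of "- 1"]
    by (simp add: u env_proj_mult env_proj_minus scalar_simps)
qed

lemma std_filtration_zero: "\<zero>\<^bsub>enveloping_algebra scale br\<^esub> \<in> std_filtration scale br n"
proof -
  have "\<exists>u. u \<in> std_filtration scale br n"
  proof (induction n rule: nat_less_induct)
    case (1 n)
    consider "n = 0" | "n = Suc 0" | m where "n = Suc (Suc m)"
      by (metis not0_implies_Suc)
    then show ?case
    proof cases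
      case 2
      then show ?thesis by (auto simp: plus_scalars_def)
    next
      case (3 m)
      then show ?thesis using 1 by (metis ideal_prod.prod lessI std_filtration.simps(3) zero_less_Suc Suc_less_eq)
    qed auto
  qed
  then obtain u where u: "u \<in> std_filtration scale br n" by blast
  then obtain p where "u = env_proj scale br p"
    using std_filtration_subset carrier_enveloping_algebra by blast
  then show ?thesis
    using std_filtration_scalar[OF u, of 0] by (simp add: env_proj_mult scalar_simps env_proj_zero)
qed

lemma std_filtration_mult:
  assumes "u \<in> std_filtration scale br m" "v \<in> std_filtration scale br n"
  shows "u \<otimes>\<^bsub>enveloping_algebra scale br\<^esub> v \<in> std_filtration scale br (m + n)"
proof -
  interpret U: ring "enveloping_algebra scale br" by (rule ring_enveloping_algebra)
  have 1: "u \<otimes>\<^bsub>enveloping_algebra scale br\<^esub> v \<in> std_filtration scale br (Suc n)"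
    if u: "u \<in> std_filtration scale br (Suc 0)" and v: "v \<in> std_filtration scale br n" for u v n
  proof (cases n)
    case 0
    obtain p where p: "u = env_proj scale br p"
      using u std_filtration_subset carrier_enveloping_algebra by blast
    obtain c where c: "v = env_proj scale br (scalar c)"
      using v 0 by (auto simp: env_scalar_def)
    show ?thesis
      using std_filtration_scalar[OF u, of c] 0
      by (simp add: c p env_proj_mult scalar_mult_commute)
  next
    case (Suc k)
    then show ?thesis using u v by (simp add: ideal_prod.prod)
  qed
  show ?thesis using assms(1)
  proof (induction m arbitrary: u)
    case 0
    then show ?case using std_filtration_scalar[OF assms(2)] by (auto simp: env_scalar_def)
  next
    case (Suc m)
    show ?case
    proof (cases m)
      case 0
      then show ?thesis using Suc.prems 1[OF _ assms(2)] by simp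
    next
      case (Suc k)
      have v: "v \<in> carrier (enveloping_algebra scale br)"
        using assms(2) std_filtration_subset by blast
      have "u \<in> ideal_prod (enveloping_algebra scale br) (std_filtration scale br (Suc 0)) (std_filtration scale br m)"
        using Suc.prems Suc by simp
      then have "u \<otimes>\<^bsub>enveloping_algebra scale br\<^esub> v \<in> std_filtration scale br (Suc m + n)
          \<and> u \<in> carrier (enveloping_algebra scale br)"
      proof (induction rule: ideal_prod.induct)
        case (prod i j)
        then have ij: "i \<in> carrier (enveloping_algebra scale br)" "j \<in> carrier (enveloping_algebra scale br)"
          using std_filtration_subset by blast+
        show ?case using 1[OF prod(1) Suc.IH[OF prod(2)]] ij v by (simp add: U.m_assoc)
      next
        case (sum s1 s2)
        then show ?case using std_filtration_add v by (simp add: U.l_distr)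
      qed
      then show ?thesis by simp
    qed
  qed
qed

end


section \<open>The homogenized enveloping algebra\<close>

text \<open>
  The Rees ring \<open>\<Oplus>\<^sub>n U\<^sub>n z\<^sup>n\<close>, as a subring of \<open>U[z]\<close>. In \<^const>\<open>UP\<close> the indeterminate commutes
  with the coefficients, also over a noncommutative ring.
\<close>

definition homogenized_enveloping_algebra ::
    "('k::field \<Rightarrow> 'g::ab_group_add \<Rightarrow> 'g) \<Rightarrow> ('g \<Rightarrow> 'g \<Rightarrow> 'g) \<Rightarrow>
      (('g list \<Rightarrow>\<^sub>0 'k) set, nat \<Rightarrow> ('g list \<Rightarrow>\<^sub>0 'k) set) up_ring"
  where "homogenized_enveloping_algebra scale br =
    (UP (enveloping_algebra scale br))
      \<lparr>carrier := {p \<in> carrier (UP (enveloping_algebra scale br)).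
         \<forall>n. up_ring.coeff (UP (enveloping_algebra scale br)) p n \<in> std_filtration scale br n}\<rparr>"

lemma (in lie_algebra) ring_homogenized: "ring (homogenized_enveloping_algebra scale br)"
proof -
  define U where "U = enveloping_algebra scale br"
  interpret U: ring U unfolding U_def by (rule ring_enveloping_algebra)
  interpret P: UP_ring U "UP U" by unfold_locales simp
  let ?H = "{p \<in> carrier (UP U). \<forall>n. up_ring.coeff (UP U) p n \<in> std_filtration scale br n}"
  have zero: "\<zero>\<^bsub>U\<^esub> \<in> std_filtration scale br n" for n
    unfolding U_def by (rule std_filtration_zero)
  have sum: "(\<Oplus>\<^bsub>U\<^esub>i\<in>A. f i) \<in> std_filtration scale br n"
    if "finite A" "\<And>i. i \<in> A \<Longrightarrow> f i \<in> std_filtration scale br n" for A n and f :: "nat \<Rightarrow> _"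
    using that
  proof (induction A rule: finite_induct)
    case empty
    then show ?case using zero by simp
  next
    case (insert i A)
    have "f \<in> A \<rightarrow> carrier U" "f i \<in> carrier U"
      using insert.prems std_filtration_subset unfolding U_def by blast+
    then show ?case
      using insert by (simp add: U.finsum_insert) (simp add: U_def std_filtration_add)
  qed
  have one: "\<one>\<^bsub>U\<^esub> \<in> std_filtration scale br 0"
    by (simp add: U_def env_proj_one env_scalar_def flip: scalar_simps)
  have "subring ?H (UP U)"
  proof (rule ring.subringI)
    show "ring (UP U)" by (rule P.UP_ring)
    show "\<one>\<^bsub>UP U\<^esub> \<in> ?H"
      using one zero by (auto simp: P.coeff_one)
  next
    fix h assume "h \<in> ?H"
    then show "\<ominus>\<^bsub>UP U\<^esub> h \<in> ?H"
      using std_filtration_minus by (auto simp: P.coeff_a_inv) (simp add: U_def)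
  next
    fix h1 h2 assume h: "h1 \<in> ?H" "h2 \<in> ?H"
    show "h1 \<oplus>\<^bsub>UP U\<^esub> h2 \<in> ?H"
      using h std_filtration_add by (auto simp: P.coeff_add) (simp add: U_def)
    have "up_ring.coeff (UP U) h1 i \<otimes>\<^bsub>U\<^esub> up_ring.coeff (UP U) h2 (n - i) \<in> std_filtration scale br n"
      if "i \<le> n" for i n
      using std_filtration_mult[of "up_ring.coeff (UP U) h1 i" i "up_ring.coeff (UP U) h2 (n - i)" "n - i"]
        h that by (simp add: U_def)
    then show "h1 \<otimes>\<^bsub>UP U\<^esub> h2 \<in> ?H"
      using h by (auto simp: P.coeff_mult intro!: sum)
  qed auto
  then show ?thesis
    unfolding homogenized_enveloping_algebra_def U_def[symmetric]
    by (rule ring.subring_is_ring[OF P.UP_ring])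
qed

definition X_tilde ::
    "('k::field \<Rightarrow> 'g::ab_group_add \<Rightarrow> 'g) \<Rightarrow> ('g \<Rightarrow> 'g \<Rightarrow> 'g) \<Rightarrow> (nat \<Rightarrow> ('g list \<Rightarrow>\<^sub>0 'k) set) set"
  where "X_tilde scale br =
    {up_ring.monom (UP (enveloping_algebra scale br)) x 1 | x.
       x \<in> plus_scalars scale br (X_prime scale br)}"

lemma X_tilde_subset:
  assumes "lie_algebra scale br"
  shows "X_tilde scale br \<subseteq> carrier (homogenized_enveloping_algebra scale br)"
proof
  fix L assume "L \<in> X_tilde scale br"
  then obtain x where x: "x \<in> std_filtration scale br 1"
    and L: "L = up_ring.monom (UP (enveloping_algebra scale br)) x 1"
    by (fastforce simp: X_tilde_def plus_scalars_def)
  interpret U: ring "enveloping_algebra scale br" by (rule ring_enveloping_algebra)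
  interpret P: UP_ring "enveloping_algebra scale br" "UP (enveloping_algebra scale br)"
    by unfold_locales simp
  have "x \<in> carrier (enveloping_algebra scale br)"
    using x std_filtration_subset by blast
  then show "L \<in> carrier (homogenized_enveloping_algebra scale br)"
    using x lie_algebra.std_filtration_zero[OF assms]
    by (auto simp: L homogenized_enveloping_algebra_def P.monom_closed P.coeff_monom)
qed


section \<open>Left modules\<close>

text \<open>
  The library locale \<^locale>\<open>Module.module\<close> is restricted to commutative rings, so only its
  record type is reused; the fields \<^const>\<open>monoid.mult\<close> and \<^const>\<open>one\<close> carry no meaning for
  a module.
\<close>

locale left_module = R?: ring R + M?: abelian_group M
  for R :: "('r, 'm) ring_scheme" (structure) and M :: "('r, 'a, 'n) module_scheme" (structure) +
  assumes smult_closed: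
      "\<lbrakk>a \<in> carrier R; x \<in> carrier M\<rbrakk> \<Longrightarrow> a \<odot>\<^bsub>M\<^esub> x \<in> carrier M"
    and smult_l_distr:
      "\<lbrakk>a \<in> carrier R; b \<in> carrier R; x \<in> carrier M\<rbrakk> \<Longrightarrow>
        (a \<oplus> b) \<odot>\<^bsub>M\<^esub> x = a \<odot>\<^bsub>M\<^esub> x \<oplus>\<^bsub>M\<^esub> b \<odot>\<^bsub>M\<^esub> x"
    and smult_r_distr:
      "\<lbrakk>a \<in> carrier R; x \<in> carrier M; y \<in> carrier M\<rbrakk> \<Longrightarrow>
        a \<odot>\<^bsub>M\<^esub> (x \<oplus>\<^bsub>M\<^esub> y) = a \<odot>\<^bsub>M\<^esub> x \<oplus>\<^bsub>M\<^esub> a \<odot>\<^bsub>M\<^esub> y"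
    and smult_assoc:
      "\<lbrakk>a \<in> carrier R; b \<in> carrier R; x \<in> carrier M\<rbrakk> \<Longrightarrow>
        (a \<otimes> b) \<odot>\<^bsub>M\<^esub> x = a \<odot>\<^bsub>M\<^esub> (b \<odot>\<^bsub>M\<^esub> x)"
    and smult_one: "x \<in> carrier M \<Longrightarrow> \<one> \<odot>\<^bsub>M\<^esub> x = x"

definition left_annihilator :: "('r, 'm) ring_scheme \<Rightarrow> ('r, 'a, 'n) module_scheme \<Rightarrow> 'r set"
  where "left_annihilator R M = {r \<in> carrier R. \<forall>m \<in> carrier M. r \<odot>\<^bsub>M\<^esub> m = \<zero>\<^bsub>M\<^esub>}"

definition faithful_left_module :: "('r, 'm) ring_scheme \<Rightarrow> ('r, 'a, 'n) module_scheme \<Rightarrow> bool"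
  where "faithful_left_module R M \<longleftrightarrow> left_module R M \<and> left_annihilator R M = {\<zero>\<^bsub>R\<^esub>}"

text \<open>
  The quotient of \<open>R\<close> by a left ideal \<open>J\<close>, with elements the additive cosets of \<open>J\<close>; the action
  \<open>r (J + c) = J + r c\<close> is defined as in \<^const>\<open>rcoset_mult\<close> by a union over representatives.
\<close>

definition quotient_left_module :: "('r, 'm) ring_scheme \<Rightarrow> 'r set \<Rightarrow> ('r, 'r set) module"
  where "quotient_left_module R J =
    \<lparr>carrier = a_rcosets\<^bsub>R\<^esub> J, monoid.mult = undefined, one = undefined,
     ring.zero = J, add = set_add R,
     module.smult = (\<lambda>r C. \<Union>c\<in>C. J +>\<^bsub>R\<^esub> (r \<otimes>\<^bsub>R\<^esub> c))\<rparr>"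

lemma (in ring) left_module_quotient:
  assumes J: "additive_subgroup J R" and l: "\<And>a x. a \<in> carrier R \<Longrightarrow> x \<in> J \<Longrightarrow> a \<otimes> x \<in> J"
  shows "left_module R (quotient_left_module R J)"
proof -
  interpret J: abelian_subgroup J R
    using J by (intro abelian_subgroupI3 abelian_group_axioms)
  let ?M = "quotient_left_module R J"
  have act: "a \<odot>\<^bsub>?M\<^esub> (J +> x) = J +> a \<otimes> x" if a: "a \<in> carrier R" and x: "x \<in> carrier R" for a x
  proof -
    have "J +> a \<otimes> c = J +> a \<otimes> x" if "c \<in> J +> x" for c
    proof -
      from that obtain j where j: "j \<in> J" "c = j \<oplus> x" by (auto simp: a_r_coset_def')
      have "a \<otimes> c = a \<otimes> j \<oplus> a \<otimes> x" using j a x J.a_Hcarr by (simp add: r_distr)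
      then have "a \<otimes> c \<in> J +> a \<otimes> x" using l[OF a j(1)] by (auto simp: a_r_coset_def')
      then show ?thesis using a x a_repr_independence[of "a \<otimes> c" J "a \<otimes> x"] J.a_subgroup by simp
    qed
    then have "(\<Union>c\<in>J +> x. J +> (a \<otimes> c)) = (\<Union>c\<in>J +> x. J +> a \<otimes> x)"
      by (intro SUP_cong refl)
    moreover have "x \<in> J +> x" using x J.a_rcos_self by blast
    ultimately show ?thesis
      by (simp add: quotient_left_module_def UN_constant del: UN_simps) blast
  qed
  have add: "(J +> x) \<oplus>\<^bsub>?M\<^esub> (J +> y) = J +> (x \<oplus> y)"
    if "x \<in> carrier R" "y \<in> carrier R" for x y
    using that by (simp add: quotient_left_module_def J.a_rcos_sum)
  have car: "carrier ?M = (+>) J ` carrier R"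
    by (auto simp: quotient_left_module_def A_RCOSETS_def')
  have zero: "\<zero>\<^bsub>?M\<^esub> = J +> \<zero>"
    by (simp add: quotient_left_module_def J.a_subset)
  have "abelian_group ?M"
  proof (rule abelian_groupI)
    fix x assume "x \<in> carrier ?M"
    then obtain a where "x = J +> a" "a \<in> carrier R" by (auto simp: car)
    then show "\<exists>y\<in>carrier ?M. y \<oplus>\<^bsub>?M\<^esub> x = \<zero>\<^bsub>?M\<^esub>"
      by (auto simp: car zero add l_neg intro!: bexI[of _ "\<ominus> a"])
  qed (auto simp: car zero add a_ac)
  then show ?thesis
    by (intro left_module.intro left_module_axioms.intro ring_axioms)
       (auto simp: car add act l_distr r_distr m_assoc)
qed

lemma (in ring) additive_subgroup_left_multiples:
  assumes "a \<in> carrier R"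
  shows "additive_subgroup (carrier R #> a) R"
proof (intro additive_subgroup.intro add.subgroupI)
  show "carrier R #> a \<subseteq> carrier R" "carrier R #> a \<noteq> {}"
    using assms by (auto simp: r_coset_def)
next
  fix x assume "x \<in> carrier R #> a"
  then obtain r where r: "r \<in> carrier R" "x = r \<otimes> a" by (auto simp: r_coset_def)
  then have "\<ominus> x = (\<ominus> r) \<otimes> a" using assms by (simp add: l_minus)
  then show "\<ominus> x \<in> carrier R #> a" using r by (auto simp: r_coset_def)
next
  fix x y assume "x \<in> carrier R #> a" "y \<in> carrier R #> a"
  then obtain r s where "r \<in> carrier R" "x = r \<otimes> a" "s \<in> carrier R" "y = s \<otimes> a"
    by (auto simp: r_coset_def)
  moreover from this have "x \<oplus> y = (r \<oplus> s) \<otimes> a" using assms by (simp add: l_distr)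
  ultimately show "x \<oplus> y \<in> carrier R #> a" by (auto simp: r_coset_def)
qed

lemma (in ring) left_module_quotient_principal:
  assumes "a \<in> carrier R"
  shows "left_module R (quotient_left_module R (carrier R #> a))"
proof (rule left_module_quotient[OF additive_subgroup_left_multiples[OF assms]])
  fix r x assume "r \<in> carrier R" "x \<in> carrier R #> a"
  then show "r \<otimes> x \<in> carrier R #> a"
    using assms by (auto simp: r_coset_def simp flip: m_assoc)
qed

end

theory Submission
  imports Defs "HOL-Library.Multiset_Order"
begin

text \<open>
  Let \<open>L = x z\<close> with \<open>x = x' + \<mu>\<close> and \<open>x' \<in> X'\<close>. If \<open>r\<close> annihilates \<open>H / H L\<close>, comparing the
  coefficients in \<open>r (v z\<^sup>m) \<in> H L\<close> shows that each coefficient \<open>u\<close> of \<open>r\<close> satisfies \<open>u v \<in> U x\<close> for all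
  \<open>v\<close> in \<open>U\<close>, because the filtration exhausts \<open>U\<close>. So it suffices that the \<open>U\<close>-module \<open>U / U x\<close> is
  faithful, which is \<open>quotient_of_enveloping_algebra_faithful\<close>.

  The main tool is the Poincare-Birkhoff-Witt theorem. A basis \<open>e 0, e 1, \<dots>\<close> with \<open>e 0 = x'\<close> is
  chosen, the Lie algebra is made to act on the polynomial ring in the basis letters
  (\<open>op_bracket_Mon\<close>), and \<open>u \<mapsto> u \<cdot> 1\<close> embeds \<open>U\<close> into this ring (\<open>to_poly_eq_0_iff\<close>). Monomials stand for
  products in decreasing order, so right multiplication by \<open>x\<close> becomes multiplication by
  \<open>X\<^sub>0 + \<mu>\<close>. If moreover \<open>[e 0, e 1] = \<lambda> e 1\<close>, right multiplication by \<open>e 1\<close> is the substitution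
  \<open>X\<^sub>0 \<mapsto> X\<^sub>0 + \<lambda>\<close> followed by multiplication by \<open>X\<^sub>1\<close>, because \<open>e 0 e 1 = e 1 (e 0 + \<lambda>)\<close>.

  If \<open>\<gg>\<close> is not nilpotent, \<open>ad x'\<close> has an eigenvector \<open>e 1\<close> with eigenvalue \<open>\<lambda> \<noteq> 0\<close>. An annihilator
  \<open>u\<close> of \<open>U / U x\<close> satisfies \<open>u (e 1)\<^sup>m \<in> U x\<close> for all \<open>m\<close>, that is, the polynomial of \<open>u\<close> vanishes under
  all the substitutions \<open>X\<^sub>0 \<mapsto> m \<lambda> - \<mu>\<close>. These are infinitely many roots, so \<open>u = 0\<close> (\<open>faithful_eigen\<close>).

  If \<open>\<gg>\<close> is nilpotent, there is \<open>y\<close> such that \<open>e 1 = [y, x']\<close> is nonzero and commutes with \<open>x'\<close>. The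
  annihilator is a two-sided ideal and \<open>ad y\<close> is locally nilpotent on \<open>U\<close>, so a nonzero annihilator
  contains some \<open>u \<noteq> 0\<close> with \<open>[y, u] = 0\<close>. If \<open>u = v x\<^sup>k\<close> with \<open>k \<ge> 1\<close>, the product rule gives
  \<open>[y, v] x + k v (e 1) = 0\<close> after cancelling \<open>x\<^sup>k\<^sup>-\<^sup>1\<close>; as \<open>e 1\<close> can be cancelled modulo \<open>U x\<close>, this yields
  \<open>v \<in> U x\<close>. Since \<open>u \<in> U x\<close> to begin with, \<open>u\<close> is a right multiple of every power of \<open>x\<close>, which is
  impossible for degree reasons (\<open>faithful_commuting\<close>).
\<close>

section \<open>Linear maps out of monoid algebras\<close>

lemma lookup_scale: "Poly_Mapping.lookup (Poly_Mapping.single 0 c * p) M = c * Poly_Mapping.lookup p M"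
  for p :: "'a::monoid_add \<Rightarrow>\<^sub>0 'k::field"
  by (simp flip: mult_map_scale_conv_mult add: Poly_Mapping.map.rep_eq when_def)

text \<open>
  The same construction serves to define operators on the polynomial ring, the representation of
  the free algebra, the passage from polynomials to ordered products and the rewriting of a
  polynomial as a polynomial in one distinguished variable; only the embedding \<open>h\<close> of the scalars
  into the target varies.
\<close>

locale scalar_embedding =
  fixes h :: "'k::field \<Rightarrow> 'b::ring_1"
  assumes h_add: "h (a + b) = h a + h b"
    and h_mult: "h (a * b) = h a * h b"
    and h_one: "h 1 = 1"
    and h_central: "h a * r = r * h a"
begin

lemma h_zero: "h 0 = 0"
  using h_add[of 0 0] by simp

definition lin_ext :: "('a \<Rightarrow> 'b) \<Rightarrow> ('a \<Rightarrow>\<^sub>0 'k) \<Rightarrow> 'b"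
  where "lin_ext f p = (\<Sum>M\<in>Poly_Mapping.keys p. h (Poly_Mapping.lookup p M) * f M)"

lemma lin_ext_eq_sum:
  assumes "finite A" "Poly_Mapping.keys p \<subseteq> A"
  shows "lin_ext f p = (\<Sum>M\<in>A. h (Poly_Mapping.lookup p M) * f M)"
  unfolding lin_ext_def
  by (rule sum.mono_neutral_left[OF assms]) (auto simp: in_keys_iff h_zero)

lemma lin_ext_zero: "lin_ext f 0 = 0"
  by (simp add: lin_ext_def)

lemma lin_ext_single: "lin_ext f (Poly_Mapping.single M c) = h c * f M"
  by (subst lin_ext_eq_sum[of "{M}"]) auto

lemma lin_ext_add: "lin_ext f (p + q) = lin_ext f p + lin_ext f q"
proof -
  let ?A = "Poly_Mapping.keys p \<union> Poly_Mapping.keys q"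
  have "Poly_Mapping.keys (p + q) \<subseteq> ?A" by (rule keys_add)
  then show ?thesis
    by (simp add: lin_ext_eq_sum[of ?A] lookup_add h_add distrib_right sum.distrib)
qed

lemma lin_ext_scale: "lin_ext f (Poly_Mapping.single 0 c * p) = h c * lin_ext f p"
  for f :: "'a::monoid_add \<Rightarrow> 'b"
proof -
  have "Poly_Mapping.keys (Poly_Mapping.single 0 c * p) \<subseteq> Poly_Mapping.keys p"
    by (auto simp: in_keys_iff lookup_scale)
  then show ?thesis
    by (simp add: lin_ext_eq_sum[of "Poly_Mapping.keys p"] lookup_scale h_mult sum_distrib_left mult.assoc)
qed

lemma lin_ext_minus: "lin_ext f (- p) = - lin_ext f p"
  using lin_ext_add[of f p "- p"] by (simp add: lin_ext_zero add_eq_0_iff)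

lemma lin_ext_diff: "lin_ext f (p - q) = lin_ext f p - lin_ext f q"
  using lin_ext_add[of f p "- q"] by (simp add: lin_ext_minus)

lemma lin_ext_sum: "lin_ext f (sum g A) = (\<Sum>a\<in>A. lin_ext f (g a))"
  by (induction A rule: infinite_finite_induct) (simp_all add: lin_ext_zero lin_ext_add)

end

lemma poly_mapping_as_sum: "p = (\<Sum>M\<in>Poly_Mapping.keys p. Poly_Mapping.single M (Poly_Mapping.lookup p M))"
proof (rule poly_mapping_eqI)
  fix k
  have "(\<Sum>M\<in>Poly_Mapping.keys p. Poly_Mapping.lookup p M when M = k)
      = (\<Sum>M\<in>Poly_Mapping.keys p. if M = k then Poly_Mapping.lookup p M else 0)"
    by (simp add: when_def)
  then show "Poly_Mapping.lookup p k = Poly_Mapping.lookup (\<Sum>M\<in>Poly_Mapping.keys p. Poly_Mapping.single M (Poly_Mapping.lookup p M)) k"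
    by (simp add: lookup_sum lookup_single sum.delta in_keys_iff)
qed

lemma poly_mapping_keys_induct [case_names zero single add]:
  assumes "P 0"
    and "\<And>M c. M \<in> Poly_Mapping.keys p \<Longrightarrow> P (Poly_Mapping.single M c)"
    and "\<And>q r. P q \<Longrightarrow> P r \<Longrightarrow> P (q + r)"
  shows "P (p :: 'a \<Rightarrow>\<^sub>0 'k::comm_monoid_add)"
proof -
  have "P (\<Sum>M\<in>A. Poly_Mapping.single M (Poly_Mapping.lookup p M))"
    if "finite A" "A \<subseteq> Poly_Mapping.keys p" for A
    using that by (induction A rule: finite_induct) (auto intro: assms)
  from this[of "Poly_Mapping.keys p"] show ?thesis
    using poly_mapping_as_sum[of p] by simp
qed

lemma (in scalar_embedding) lin_ext_mult:
  fixes f :: "'a::monoid_add \<Rightarrow> 'b"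
  assumes f: "\<And>M N. f (M + N) = f M * f N"
  shows "lin_ext f (p * q) = lin_ext f p * lin_ext f q"
proof (induction p rule: poly_mapping_keys_induct)
  case (single M c)
  show ?case
  proof (induction q rule: poly_mapping_keys_induct)
    case (single N d)
    have "h c * (h d * (f M * f N)) = h c * (f M * (h d * f N))"
      by (metis h_central mult.assoc)
    then show ?case by (simp add: mult_single lin_ext_single f h_mult mult.assoc)
  qed (simp_all add: lin_ext_add lin_ext_zero distrib_left)
qed (simp_all add: lin_ext_add lin_ext_zero distrib_right)

section \<open>Polynomials as linear combinations of multisets\<close>

type_synonym 'k sym_alg = "nat multiset \<Rightarrow>\<^sub>0 'k"

definition Cst :: "'k::field \<Rightarrow> 'k sym_alg"
  where "Cst c = Poly_Mapping.single 0 c"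

definition Mon :: "nat multiset \<Rightarrow> 'k::field sym_alg"
  where "Mon M = Poly_Mapping.single M 1"

definition Var :: "nat \<Rightarrow> 'k::field sym_alg"
  where "Var i = Mon {#i#}"

lemma Mon_add: "Mon (M + N) = Mon M * Mon N"
  by (simp add: Mon_def mult_single)

lemma Mon_add_mset: "Mon (add_mset i M) = Var i * Mon M"
  by (simp add: Var_def flip: Mon_add)

lemma Mon_empty: "Mon {#} = 1"
  by (simp add: Mon_def)

lemma single_eq_Cst_Mon: "Poly_Mapping.single M c = Cst c * Mon M"
  by (simp add: Mon_def Cst_def mult_single)

lemma Cst_simps:
  "Cst 0 = 0" "Cst 1 = 1" "Cst (a + b) = Cst a + Cst b" "Cst (a * b) = Cst a * Cst b"
  "Cst (- a) = - Cst a" "Cst (a - b) = Cst a - Cst b"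
  by (simp_all add: Cst_def single_add mult_single single_uminus single_diff)

lemma lookup_Cst_mult: "Poly_Mapping.lookup (Cst c * p) M = c * Poly_Mapping.lookup p M"
  by (simp add: Cst_def lookup_scale)

interpretation SE: scalar_embedding Cst
  by unfold_locales (simp_all add: Cst_simps mult.commute)

lemma SE_lin_ext_Mon: "SE.lin_ext f (Mon M) = f M"
  by (simp add: Mon_def SE.lin_ext_single Cst_simps)

lemma SE_lin_ext_Cst: "SE.lin_ext f (Cst c * p) = Cst c * SE.lin_ext f p"
  for f :: "nat multiset \<Rightarrow> _"
  unfolding Cst_def[of c] SE.lin_ext_scale by (simp add: Cst_def)

definition linear_op :: "('k::field sym_alg \<Rightarrow> 'k sym_alg) \<Rightarrow> bool"
  where "linear_op F \<longleftrightarrow>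
    (\<forall>p q. F (p + q) = F p + F q) \<and> (\<forall>c p. F (Cst c * p) = Cst c * F p)"

lemma linear_op_add: "linear_op F \<Longrightarrow> F (p + q) = F p + F q"
  and linear_op_Cst: "linear_op F \<Longrightarrow> F (Cst c * p) = Cst c * F p"
  by (auto simp: linear_op_def)

lemma linear_op_zero: "linear_op F \<Longrightarrow> F 0 = 0"
  using linear_op_Cst[of F 0 0] by (simp add: Cst_simps)

lemma linear_op_diff: "linear_op F \<Longrightarrow> F (p - q) = F p - F q"
  using linear_op_add[of F "p - q" q] by simp

lemma linear_op_sum: "linear_op F \<Longrightarrow> F (sum g A) = (\<Sum>a\<in>A. F (g a))"
  by (induction A rule: infinite_finite_induct) (simp_all add: linear_op_zero linear_op_add)

lemma linear_op_lin_ext: "linear_op (SE.lin_ext f)"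
  by (simp add: linear_op_def SE.lin_ext_add SE_lin_ext_Cst)

lemma linear_op_compose: "linear_op F \<Longrightarrow> linear_op G \<Longrightarrow> linear_op (\<lambda>s. F (G s))"
  and linear_op_plus: "linear_op F \<Longrightarrow> linear_op G \<Longrightarrow> linear_op (\<lambda>s. F s + G s)"
  and linear_op_times: "linear_op F \<Longrightarrow> linear_op (\<lambda>s. F s * r)"
  and linear_op_id: "linear_op (\<lambda>s. s)"
  by (auto simp: linear_op_def algebra_simps)

lemma linear_op_mult_left: "linear_op F \<Longrightarrow> linear_op (\<lambda>s. r * F s)"
  using linear_op_times[of F r] by (simp add: mult.commute)

lemma linear_op_sum_ops: "(\<And>a. a \<in> A \<Longrightarrow> linear_op (F a)) \<Longrightarrow> linear_op (\<lambda>s. \<Sum>a\<in>A. F a s)"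
  by (auto simp: linear_op_def sum.distrib sum_distrib_left)

lemma linear_op_eqI:
  assumes "linear_op F" "linear_op G"
    and "\<And>M. M \<in> Poly_Mapping.keys p \<Longrightarrow> F (Mon M) = G (Mon M)"
  shows "F p = G p"
proof (induction p rule: poly_mapping_keys_induct)
  case zero
  show ?case using assms(1,2) by (simp add: linear_op_zero)
next
  case (single M c)
  then show ?case using assms by (simp add: single_eq_Cst_Mon linear_op_Cst)
next
  case (add q r)
  then show ?case using assms(1,2) by (simp add: linear_op_add)
qed

definition deg_le :: "nat \<Rightarrow> 'k::field sym_alg \<Rightarrow> bool"
  where "deg_le d p \<longleftrightarrow> (\<forall>M\<in>Poly_Mapping.keys p. size M \<le> d)"

lemma deg_le_mono: "deg_le d p \<Longrightarrow> d \<le> d' \<Longrightarrow> deg_le d' p"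
  by (force simp: deg_le_def)

lemma deg_le_zero: "deg_le d 0"
  by (simp add: deg_le_def)

lemma deg_le_add: "deg_le d p \<Longrightarrow> deg_le d q \<Longrightarrow> deg_le d (p + q)"
  using keys_add[of p q] by (auto simp: deg_le_def)

lemma deg_le_Cst_mult: "deg_le d p \<Longrightarrow> deg_le d (Cst c * p)"
  by (auto simp: deg_le_def in_keys_iff lookup_Cst_mult)

lemma deg_le_sum: "(\<And>a. a \<in> A \<Longrightarrow> deg_le d (f a)) \<Longrightarrow> deg_le d (sum f A)"
  by (induction A rule: infinite_finite_induct) (simp_all add: deg_le_zero deg_le_add)

lemma deg_le_Mon: "size M \<le> d \<Longrightarrow> deg_le d (Mon M)"
  by (simp add: deg_le_def Mon_def)

section \<open>Calculations in a Lie algebra and modulo the enveloping ideal\<close>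

context lie_algebra
begin

lemma br_antisym: "br x y = - br y x"
proof -
  have "br x y + br y x = 0"
    using br_self[of "x + y"] unfolding br_add_left br_add_right by (simp add: br_self add.commute)
  then show ?thesis by (simp add: eq_neg_iff_add_eq_0)
qed

lemma br_zero_left: "br 0 y = 0" and br_zero_right: "br y 0 = 0"
  using br_add_left[of 0 0 y] br_add_right[of y 0 0] by simp_all

lemma br_minus_left: "br (- x) y = - br x y"
  using br_add_left[of x "- x" y] by (simp add: br_zero_left add_eq_0_iff)

lemma br_minus_right: "br x (- y) = - br x y"
  using br_add_right[of x y "- y"] by (simp add: br_zero_right add_eq_0_iff)

lemma br_sum_left: "br (sum f A) y = (\<Sum>a\<in>A. br (f a) y)"
  by (induction A rule: infinite_finite_induct) (simp_all add: br_zero_left br_add_left)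

lemma br_sum_right: "br y (sum f A) = (\<Sum>a\<in>A. br y (f a))"
  by (induction A rule: infinite_finite_induct) (simp_all add: br_zero_right br_add_right)

lemma of_nat_left_commute: "p * (of_nat k * q) = of_nat k * (p * q)"
  for p :: "'g list \<Rightarrow>\<^sub>0 'k"
  by (metis mult_of_nat_commute mult.assoc)

lemma ideal_add: "a \<in> enveloping_ideal scale br \<Longrightarrow> b \<in> enveloping_ideal scale br \<Longrightarrow>
    a + b \<in> enveloping_ideal scale br"
  and ideal_zero: "0 \<in> enveloping_ideal scale br"
  and ideal_mult_left: "a \<in> enveloping_ideal scale br \<Longrightarrow> p * a \<in> enveloping_ideal scale br"
  and ideal_mult_right: "a \<in> enveloping_ideal scale br \<Longrightarrow> a * p \<in> enveloping_ideal scale br"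
proof -
  interpret I: ideal "enveloping_ideal scale br" free_algebra by (rule ideal_enveloping_ideal)
  show "a \<in> enveloping_ideal scale br \<Longrightarrow> b \<in> enveloping_ideal scale br \<Longrightarrow>
    a + b \<in> enveloping_ideal scale br"
    using additive_subgroup.a_closed[OF I.is_additive_subgroup, of a b] by (simp add: ring_of_type_algebra_def)
  show "0 \<in> enveloping_ideal scale br"
    using additive_subgroup.zero_closed[OF I.is_additive_subgroup] by (simp add: ring_of_type_algebra_def)
  show "a \<in> enveloping_ideal scale br \<Longrightarrow> p * a \<in> enveloping_ideal scale br"
    using I.I_l_closed[of a p] by (simp add: ring_of_type_algebra_def)
  show "a \<in> enveloping_ideal scale br \<Longrightarrow> a * p \<in> enveloping_ideal scale br"
    using I.I_r_closed[of a p] by (simp add: ring_of_type_algebra_def)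
qed

lemma ideal_minus: "a \<in> enveloping_ideal scale br \<Longrightarrow> - a \<in> enveloping_ideal scale br"
  using ideal_mult_left[of a "- 1"] by simp

lemma ideal_diff: "a \<in> enveloping_ideal scale br \<Longrightarrow> b \<in> enveloping_ideal scale br \<Longrightarrow>
    a - b \<in> enveloping_ideal scale br"
  using ideal_add[of a "- b"] ideal_minus[of b] by simp

lemma ideal_sum: "(\<And>a. a \<in> A \<Longrightarrow> f a \<in> enveloping_ideal scale br) \<Longrightarrow> sum f A \<in> enveloping_ideal scale br"
  by (induction A rule: infinite_finite_induct) (auto simp: ideal_zero ideal_add)

lemma gen_add_ideal: "gen (x + y) - (gen x + gen y) \<in> enveloping_ideal scale br"
  and gen_scale_ideal: "gen (scale c x) - scalar c * gen x \<in> enveloping_ideal scale br"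
  and gen_br_ideal: "gen x * gen y - gen y * gen x - gen (br x y) \<in> enveloping_ideal scale br"
  using enveloping_relations_subset[of scale br] unfolding enveloping_relations_def by blast+

lemma gen_zero_ideal: "gen 0 \<in> enveloping_ideal scale br"
  using gen_scale_ideal[of 0 0] by (simp add: scalar_simps)

end

section \<open>The action of the Lie algebra on polynomials\<close>

text \<open>
  The basis consists of the \<open>e i\<close> with \<open>i < n\<close>. The letters from \<open>n\<close> on stand for further, arbitrary
  elements of the Lie algebra; the polynomials below may thus involve all variables, and the
  recursion over monomials needs no bound on the indices.
\<close>

locale lie_basis = lie_algebra scale br
  for scale :: "'k::field \<Rightarrow> 'g::ab_group_add \<Rightarrow> 'g" and br +
  fixes n :: nat and e :: "nat \<Rightarrow> 'g" and coord :: "'g \<Rightarrow> nat \<Rightarrow> 'k"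
  assumes coord_add: "coord (v + w) i = coord v i + coord w i"
    and coord_scale: "coord (scale c v) i = c * coord v i"
    and coord_sum: "(\<Sum>k<n. scale (coord v k) (e k)) = v"
    and coord_basis: "i < n \<Longrightarrow> k < n \<Longrightarrow> coord (e i) k = (if k = i then 1 else 0)"
begin

text \<open>
  \<open>act i M\<close> is the polynomial that \<open>e i\<close> times the monomial \<open>M\<close> should be when monomials are read
  as products in decreasing order. If \<open>i\<close> is at least every letter of \<open>M\<close>, this is a monomial.
  Otherwise \<open>M\<close> begins with its largest letter \<open>j > i\<close>, and
  \<open>e i e j N = e j (e i N) + [e i, e j] N\<close>; here \<open>e i N\<close> is a known polynomial with leading term
  the monomial \<open>i N\<close>, whose product with \<open>e j\<close> is a monomial, and the remaining terms are smaller
  than \<open>M\<close>. Restricting the sum to smaller monomials makes the recursion terminate by its form.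
\<close>

function act :: "nat \<Rightarrow> nat multiset \<Rightarrow> 'k sym_alg" where
  "act i M =
    (if \<forall>j\<in>#M. j \<le> i then Mon (add_mset i M)
     else Mon (add_mset i M)
       + (\<Sum>P\<in>{P \<in> Poly_Mapping.keys (act i (M - {#Max_mset M#})). size P < size M}.
            Cst (Poly_Mapping.lookup (act i (M - {#Max_mset M#})) P) * act (Max_mset M) P)
       + (\<Sum>k<n. Cst (coord (br (e i) (e (Max_mset M))) k) * act k (M - {#Max_mset M#})))"
  by pat_completeness auto
termination
proof (relation "measure (\<lambda>(i, M). size M)")
  have smaller: "size (M - {#Max_mset M#}) < size M" if "\<not> (\<forall>j\<in>#M. j \<le> i)" for M and i :: nat
    using that by (intro size_Diff1_less Max_in) auto
  fix i x :: nat and M assume "\<not> (\<forall>j\<in>#M. j \<le> i)"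
  then show "((i, M - {#Max_mset M#}), i, M) \<in> measure (\<lambda>(i, M). size M)"
    "((i, M - {#Max_mset M#}), i, M) \<in> measure (\<lambda>(i, M). size M)"
    "((x, M - {#Max_mset M#}), i, M) \<in> measure (\<lambda>(i, M). size M)"
    using smaller by simp_all
qed simp_all

declare act.simps [simp del]

definition op :: "nat \<Rightarrow> 'k sym_alg \<Rightarrow> 'k sym_alg"
  where "op i = SE.lin_ext (act i)"

definition lie_op :: "'g \<Rightarrow> 'k sym_alg \<Rightarrow> 'k sym_alg"
  where "lie_op v s = (\<Sum>k<n. Cst (coord v k) * op k s)"

lemma linear_op: "linear_op (op i)"
  unfolding op_def by (rule linear_op_lin_ext)

lemma linear_lie_op: "linear_op (lie_op v)"
  unfolding lie_op_def by (intro linear_op_sum_ops linear_op_mult_left linear_op)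

lemma op_Mon: "op i (Mon M) = act i M"
  by (simp add: op_def SE_lin_ext_Mon)

lemma lie_op_add: "lie_op (v + w) s = lie_op v s + lie_op w s"
  by (simp add: lie_op_def coord_add Cst_simps distrib_right sum.distrib)

lemma lie_op_scale: "lie_op (scale c v) s = Cst c * lie_op v s"
  by (simp add: lie_op_def coord_scale Cst_simps sum_distrib_left mult.assoc)

lemma lie_op_zero: "lie_op 0 s = 0"
  using lie_op_scale[of 0 0 s] by (simp add: Cst_simps)

lemma lie_op_minus: "lie_op (- v) s = - lie_op v s"
  using lie_op_add[of v "- v" s] by (simp add: lie_op_zero add_eq_0_iff)

lemma lie_op_sum: "lie_op (sum f A) s = (\<Sum>a\<in>A. lie_op (f a) s)"
  by (induction A rule: infinite_finite_induct) (simp_all add: lie_op_zero lie_op_add)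

lemma lie_op_e: "i < n \<Longrightarrow> lie_op (e i) s = op i s"
proof -
  assume "i < n"
  have "Cst (coord (e i) k) * op k s = (if k = i then op k s else 0)" if "k < n" for k
    using that \<open>i < n\<close> by (simp add: coord_basis Cst_simps)
  then have "lie_op (e i) s = (\<Sum>k<n. if k = i then op k s else 0)"
    unfolding lie_op_def by (intro sum.cong) auto
  then show ?thesis using \<open>i < n\<close> by simp
qed

lemma act_max: "(\<And>j. j \<in># M \<Longrightarrow> j \<le> i) \<Longrightarrow> act i M = Mon (add_mset i M)"
  by (subst act.simps) simp

lemma act_not_max:
  assumes "\<not> (\<forall>j\<in>#M. j \<le> i)"
  shows "act i M = Mon (add_mset i M)
       + (\<Sum>P\<in>{P \<in> Poly_Mapping.keys (act i (M - {#Max_mset M#})). size P < size M}.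
            Cst (Poly_Mapping.lookup (act i (M - {#Max_mset M#})) P) * act (Max_mset M) P)
       + (\<Sum>k<n. Cst (coord (br (e i) (e (Max_mset M))) k) * act k (M - {#Max_mset M#}))"
  by (subst act.simps) (simp only: assms if_False)

text \<open>The leading term of \<open>e i M\<close> is the commutative product, whatever the order of the letters.\<close>

lemma deg_le_act_minus_leading: "deg_le (size M) (act i M - Mon (add_mset i M))"
proof (induction "size M" arbitrary: i M rule: less_induct)
  case less
  show ?case
  proof (cases "\<forall>j\<in>#M. j \<le> i")
    case True
    then show ?thesis by (simp add: act_max deg_le_zero)
  next
    case False
    define j where "j = Max_mset M"
    from False have "M \<noteq> {#}" by auto
    then have "j \<in># M" by (simp add: j_def)
    define N where "N = M - {#j#}"
    have sN: "size M = Suc (size N)" using \<open>j \<in># M\<close> by (simp add: N_def size_Suc_Diff1)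
    have act: "deg_le (size M) (act k P)" if "size P < size M" for k P
      using deg_le_add[OF deg_le_mono[OF less[of P k]] deg_le_Mon[of "add_mset k P"]] that
      by (simp add: Suc_le_eq)
    have "act i M - Mon (add_mset i M) =
       (\<Sum>P\<in>{P \<in> Poly_Mapping.keys (act i N). size P < size M}.
            Cst (Poly_Mapping.lookup (act i N) P) * act j P)
       + (\<Sum>k<n. Cst (coord (br (e i) (e j)) k) * act k N)"
      unfolding act_not_max[OF False] by (simp add: j_def N_def)
    moreover have "size N < size M" by (simp add: sN)
    ultimately show ?thesis
      by (auto intro!: deg_le_add deg_le_sum deg_le_Cst_mult act)
  qed
qed

lemma act_less:
  assumes N: "\<And>l. l \<in># N \<Longrightarrow> l \<le> j" and ij: "i < j"
  shows "act i (add_mset j N) = Mon (add_mset i (add_mset j N))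
    + op j (act i N - Mon (add_mset i N)) + lie_op (br (e i) (e j)) (Mon N)"
proof -
  let ?r = "act i N - Mon (add_mset i N)"
  have max: "Max_mset (add_mset j N) = j"
    using N by (intro Max_eqI) auto
  let ?A = "{P \<in> Poly_Mapping.keys (act i N). size P < Suc (size N)}"
  have l: "Poly_Mapping.lookup ?r P = Poly_Mapping.lookup (act i N) P" if "size P < Suc (size N)" for P
    using that by (cases "P = add_mset i N") (auto simp: lookup_minus Mon_def lookup_single)
  have keys: "Poly_Mapping.keys ?r \<subseteq> ?A"
  proof
    fix P assume P: "P \<in> Poly_Mapping.keys ?r"
    then have "size P < Suc (size N)"
      using deg_le_act_minus_leading[of N i] by (simp add: deg_le_def less_Suc_eq_le)
    then show "P \<in> ?A"
      using l[of P] P by (simp add: in_keys_iff)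
  qed
  have "op j ?r = (\<Sum>P\<in>?A. Cst (Poly_Mapping.lookup ?r P) * act j P)"
    unfolding op_def by (rule SE.lin_ext_eq_sum[OF _ keys]) simp
  also have "\<dots> = (\<Sum>P\<in>?A. Cst (Poly_Mapping.lookup (act i N) P) * act j P)"
    by (intro sum.cong refl) (simp add: l)
  finally have "op j ?r = \<dots>" .
  moreover have not_max: "\<not> (\<forall>l\<in>#add_mset j N. l \<le> i)" using ij by auto
  ultimately show ?thesis
    by (simp only: act_not_max[OF not_max] max lie_op_def op_Mon size_add_mset add_mset_remove_trivial)
qed

lemma op_max: "(\<And>j. j \<in># M \<Longrightarrow> j \<le> i) \<Longrightarrow> op i (Mon M) = Mon (add_mset i M)"
  by (simp add: op_Mon act_max)

lemma op_less:
  assumes "\<And>l. l \<in># N \<Longrightarrow> l \<le> j" and "i < j"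
  shows "op i (op j (Mon N)) = Mon (add_mset i (add_mset j N))
    + op j (op i (Mon N) - Mon (add_mset i N)) + lie_op (br (e i) (e j)) (Mon N)"
  using act_less[OF assms] by (simp add: op_max assms(1)) (simp add: op_Mon)

text \<open>
  The bracket relation in the case that the recursion for \<^const>\<open>act\<close> was designed for: one of
  the two letters is a largest one.
\<close>

lemma op_commute_max:
  assumes N: "\<And>l. l \<in># N \<Longrightarrow> l \<le> j" and ij: "i < j"
  shows "op i (op j (Mon N)) = op j (op i (Mon N)) + lie_op (br (e i) (e j)) (Mon N)"
proof -
  have "op j (Mon (add_mset i N)) = Mon (add_mset j (add_mset i N))"
    using N ij by (intro op_max) auto
  then show ?thesis
    by (simp add: op_less[OF N ij] linear_op_diff[OF linear_op] add_mset_commute)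
qed

lemma lie_op_bracket_e:
  assumes "\<And>k. op i (op k s) = op k (op i s) + lie_op (br (e i) (e k)) s"
  shows "op i (lie_op v s) = lie_op v (op i s) + lie_op (br (e i) v) s"
proof -
  have "lie_op (br (e i) v) s = lie_op (br (e i) (\<Sum>k<n. scale (coord v k) (e k))) s"
    by (simp add: coord_sum)
  also have "\<dots> = (\<Sum>k<n. Cst (coord v k) * lie_op (br (e i) (e k)) s)"
    by (simp add: br_sum_right br_scale_right lie_op_sum lie_op_scale)
  finally show ?thesis
    unfolding lie_op_def[of v]
    by (simp add: linear_op_sum[OF linear_op] linear_op_Cst[OF linear_op] assms
        distrib_left sum.distrib)
qed

text \<open>
  The operators \<^const>\<open>op\<close> satisfy the bracket relation. For a monomial \<open>k L\<close> whose largest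
  letter \<open>k\<close> exceeds both \<open>i\<close> and \<open>j\<close>, both operators are moved past \<open>e k\<close>: the leading term of
  \<open>e j L\<close> is handled by the previous lemma, everything else by induction on the degree, and the
  double brackets that arise cancel by the Jacobi identity.
\<close>

lemma op_bracket_Mon:
  "op i (op j (Mon N)) = op j (op i (Mon N)) + lie_op (br (e i) (e j)) (Mon N)"
proof (induction "size N" arbitrary: i j N rule: less_induct)
  case less
  show ?case
  proof (cases "\<forall>l\<in>#N. l \<le> i \<or> l \<le> j")
    case True
    then have le: "l \<le> max i j" if "l \<in># N" for l
      using that by (auto simp: le_max_iff_disj)
    consider "i < j" | "i = j" | "j < i" by linarith
    then show ?thesis
    proof cases
      case 1
      then have "l \<le> j" if "l \<in># N" for l using le[OF that] by simp
      from op_commute_max[OF this 1] show ?thesis .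
    next
      case 2
      show ?thesis unfolding 2 by (simp add: br_self lie_op_zero)
    next
      case 3
      then have "l \<le> i" if "l \<in># N" for l using le[OF that] by simp
      from op_commute_max[OF this 3] show ?thesis
        unfolding br_antisym[of "e i" "e j"] lie_op_minus by simp
    qed
  next
    case False
    define k where "k = Max_mset N"
    define L where "L = N - {#k#}"
    from False have "N \<noteq> {#}" by auto
    then have "k \<in># N" by (simp add: k_def)
    then have N: "N = add_mset k L" by (simp add: L_def)
    have L: "l \<le> k" if "l \<in># L" for l
      using that by (simp add: k_def L_def in_diffD)
    from False obtain l where l: "l \<in># N" "i < l" "j < l" by (auto simp: not_le)
    then have "l \<le> k" by (simp add: k_def)
    with l have ik: "i < k" "j < k" by simp_all
    have Nk: "Mon N = op k (Mon L)"
      by (simp add: N op_max L)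
    have IH: "op a (op b s) = op b (op a s) + lie_op (br (e a) (e b)) s" if "deg_le (size L) s" for a b s
    proof (rule linear_op_eqI[where p = s])
      show "linear_op (\<lambda>s. op a (op b s))"
        by (rule linear_op_compose[OF linear_op linear_op])
      show "linear_op (\<lambda>s. op b (op a s) + lie_op (br (e a) (e b)) s)"
        by (rule linear_op_plus[OF linear_op_compose[OF linear_op linear_op] linear_lie_op])
      show "op a (op b (Mon M)) = op b (op a (Mon M)) + lie_op (br (e a) (e b)) (Mon M)"
        if "M \<in> Poly_Mapping.keys s" for M
        using that \<open>deg_le (size L) s\<close> N by (intro less) (auto simp: deg_le_def less_Suc_eq_le)
    qed
    \<comment> \<open>\<open>e a\<close> moves past \<open>e k\<close> although \<open>e b L\<close> may have the same degree as \<open>k L\<close>: its leading term has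
      letters at most \<open>k\<close>, and only the rest needs the induction hypothesis.\<close>
    have past: "op a (op k (op b (Mon L)))
        = op k (op a (op b (Mon L))) + lie_op (br (e a) (e k)) (op b (Mon L))"
      if "a < k" "b < k" for a b
    proof -
      define w where "w = op b (Mon L) - Mon (add_mset b L)"
      have w: "op b (Mon L) = Mon (add_mset b L) + w" by (simp add: w_def)
      have "deg_le (size L) w"
        using deg_le_act_minus_leading[of L b] by (simp add: w_def op_Mon)
      then have 1: "op a (op k w) = op k (op a w) + lie_op (br (e a) (e k)) w"
        by (rule IH)
      have 2: "op a (op k (Mon (add_mset b L)))
        = op k (op a (Mon (add_mset b L))) + lie_op (br (e a) (e k)) (Mon (add_mset b L))"
        using that L by (intro op_commute_max) auto
      show ?thesis
        by (simp add: w linear_op_add[OF linear_op] linear_op_add[OF linear_lie_op] 1 2)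
    qed
    have degL: "deg_le (size L) (Mon L)" by (simp add: deg_le_Mon)
    have lie: "op a (lie_op v (Mon L)) = lie_op v (op a (Mon L)) + lie_op (br (e a) v) (Mon L)" for a v
      by (rule lie_op_bracket_e) (rule IH[OF degL])
    have moved: "op a (op b (Mon N)) = op k (op a (op b (Mon L)))
        + lie_op (br (e a) (e k)) (op b (Mon L)) + lie_op (br (e b) (e k)) (op a (Mon L))
        + lie_op (br (e a) (br (e b) (e k))) (Mon L)" if "a < k" "b < k" for a b
      unfolding Nk IH[OF degL, of b k]
      by (simp add: linear_op_add[OF linear_op] past[OF that] lie)
    have bracket: "lie_op (br (e i) (e j)) (Mon N)
        = op k (lie_op (br (e i) (e j)) (Mon L)) - lie_op (br (e k) (br (e i) (e j))) (Mon L)"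
    proof -
      have "op k (lie_op (br (e i) (e j)) (Mon L))
        = lie_op (br (e i) (e j)) (op k (Mon L)) + lie_op (br (e k) (br (e i) (e j))) (Mon L)"
        by (rule lie)
      then show ?thesis by (simp add: Nk)
    qed
    have "br (e i) (br (e j) (e k)) + br (e j) (br (e k) (e i)) + br (e k) (br (e i) (e j)) = 0"
      by (rule jacobi)
    then have "br (e i) (br (e j) (e k)) = br (e j) (br (e i) (e k)) - br (e k) (br (e i) (e j))"
      unfolding br_antisym[of "e k" "e i"] br_minus_right by (simp add: algebra_simps)
    then have jac: "lie_op (br (e i) (br (e j) (e k))) (Mon L)
        = lie_op (br (e j) (br (e i) (e k))) (Mon L) - lie_op (br (e k) (br (e i) (e j))) (Mon L)"
      by (simp only: diff_conv_add_uminus lie_op_add lie_op_minus)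
    have "op k (op i (op j (Mon L)))
        = op k (op j (op i (Mon L))) + op k (lie_op (br (e i) (e j)) (Mon L))"
      by (simp add: IH[OF degL, of i j] linear_op_add[OF linear_op])
    then show ?thesis
      unfolding moved[OF ik] moved[OF ik(2) ik(1)] bracket jac by simp
  qed
qed

lemma op_bracket: "op i (op j s) = op j (op i s) + lie_op (br (e i) (e j)) s"
  by (rule linear_op_eqI[where p = s, OF linear_op_compose[OF linear_op linear_op]
        linear_op_plus[OF linear_op_compose[OF linear_op linear_op] linear_lie_op] op_bracket_Mon])

lemma lie_op_bracket: "lie_op v (lie_op w s) = lie_op w (lie_op v s) + lie_op (br v w) s"
proof -
  have "lie_op (br v w) s = lie_op (br (\<Sum>k<n. scale (coord v k) (e k)) w) s"
    by (simp add: coord_sum)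
  also have "\<dots> = (\<Sum>k<n. Cst (coord v k) * lie_op (br (e k) w) s)"
    by (simp add: br_sum_left br_scale_left lie_op_sum lie_op_scale)
  finally show ?thesis
    unfolding lie_op_def[of v]
    by (simp add: linear_op_sum[OF linear_lie_op] linear_op_Cst[OF linear_lie_op]
        lie_op_bracket_e[OF op_bracket] distrib_left sum.distrib)
qed

section \<open>Polynomials as a module over the enveloping algebra\<close>

definition word_op :: "'g list \<Rightarrow> 'k sym_alg \<Rightarrow> 'k sym_alg"
  where "word_op w s = foldr lie_op w s"

definition rho :: "('g list \<Rightarrow>\<^sub>0 'k) \<Rightarrow> 'k sym_alg \<Rightarrow> 'k sym_alg"
  where "rho p s = SE.lin_ext (\<lambda>w. word_op w s) p"

lemma word_op_add: "word_op (v + w) s = word_op v (word_op w s)"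
  by (simp add: word_op_def plus_list_def)

lemma linear_word_op: "linear_op (word_op w)"
proof (induction w)
  case Nil
  then show ?case by (simp add: word_op_def[abs_def] linear_op_id)
next
  case (Cons v w)
  then show ?case using linear_op_compose[OF linear_lie_op Cons]
    by (simp add: word_op_def[abs_def])
qed

lemma linear_rho: "linear_op (rho p)"
  unfolding rho_def[abs_def] SE.lin_ext_def
  by (intro linear_op_sum_ops linear_op_mult_left linear_word_op)

lemma rho_add: "rho (p + q) s = rho p s + rho q s"
  and rho_diff: "rho (p - q) s = rho p s - rho q s"
  and rho_zero: "rho 0 s = 0"
  by (simp_all add: rho_def SE.lin_ext_add SE.lin_ext_diff SE.lin_ext_zero)

lemma rho_single: "rho (Poly_Mapping.single w c) s = Cst c * word_op w s"
  by (simp add: rho_def SE.lin_ext_single)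

lemma rho_mult: "rho (p * q) s = rho p (rho q s)"
proof (induction p rule: poly_mapping_keys_induct)
  case (single v c)
  show ?case
  proof (induction q rule: poly_mapping_keys_induct)
    case (single w d)
    show ?case
      by (simp add: mult_single rho_single word_op_add Cst_simps linear_op_Cst[OF linear_word_op] mult.assoc)
  qed (simp_all add: rho_add distrib_left linear_op_add[OF linear_rho] rho_zero linear_op_zero[OF linear_rho])
qed (simp_all add: rho_add distrib_right rho_zero)

lemma rho_gen: "rho (gen v) s = lie_op v s"
  by (simp add: gen_def rho_single word_op_def Cst_simps)

lemma rho_scalar: "rho (scalar c) s = Cst c * s"
  by (simp add: scalar_def rho_single word_op_def)

text \<open>
  The kernel of the representation is an ideal that contains the defining relations, hence it
  contains the ideal they generate.
\<close>

lemma rho_enveloping_ideal: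
  assumes "p \<in> enveloping_ideal scale br"
  shows "rho p s = 0"
proof -
  let ?K = "{p. \<forall>s. rho p s = 0}"
  interpret F: ring "free_algebra :: ('g list \<Rightarrow>\<^sub>0 'k) ring" by (rule ring_free_algebra)
  have neg: "rho (- a) s = 0" if "\<And>s. rho a s = 0" for a s
    using rho_diff[of 0 a s] that by (simp add: rho_zero)
  have inv: "\<ominus>\<^bsub>free_algebra\<^esub> a = - a" for a :: "'g list \<Rightarrow>\<^sub>0 'k"
    by (rule F.minus_equality) (auto simp: ring_of_type_algebra_def)
  have "ideal ?K free_algebra"
  proof (rule idealI[OF ring_free_algebra])
    show "subgroup ?K (add_monoid free_algebra)"
    proof (rule F.add.subgroupI)
      have "0 \<in> ?K" by (simp add: rho_zero)
      then show "?K \<noteq> {}" by blast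
      show "\<ominus>\<^bsub>free_algebra\<^esub> a \<in> ?K" if "a \<in> ?K" for a
        using that unfolding inv by (simp add: neg)
    qed (auto simp: ring_of_type_algebra_def rho_add)
  qed (auto simp: ring_of_type_algebra_def rho_mult linear_op_zero[OF linear_rho])
  moreover have "rho (gen x * gen y - gen y * gen x - gen (br x y)) s = 0" for x y s
    using lie_op_bracket[of x y s] by (simp add: rho_diff rho_mult rho_gen)
  then have "enveloping_relations scale br \<subseteq> ?K"
    by (auto simp: enveloping_relations_def rho_diff rho_add rho_mult rho_gen rho_scalar
        lie_op_add lie_op_scale)
  ultimately have "enveloping_ideal scale br \<subseteq> ?K"
    unfolding enveloping_ideal_def by (rule F.genideal_minimal)
  then show ?thesis using assms by blast
qed

text \<open>The orbit map of the polynomial \<open>1\<close>, which will turn out to be injective on \<open>U\<close>.\<close>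

definition to_poly :: "('g list \<Rightarrow>\<^sub>0 'k) \<Rightarrow> 'k sym_alg"
  where "to_poly p = rho p 1"

lemma to_poly_add: "to_poly (p + q) = to_poly p + to_poly q"
  and to_poly_diff: "to_poly (p - q) = to_poly p - to_poly q"
  by (simp_all add: to_poly_def rho_add rho_diff)

lemma to_poly_cong: "p - q \<in> enveloping_ideal scale br \<Longrightarrow> to_poly p = to_poly q"
  using rho_enveloping_ideal[of "p - q" 1] by (simp add: to_poly_def rho_diff)

text \<open>The letters decrease from left to right, so that the letter \<open>0\<close> can be split off on the right.\<close>

definition ordered_prod :: "nat multiset \<Rightarrow> 'g list \<Rightarrow>\<^sub>0 'k"
  where "ordered_prod M = prod_list (map (\<lambda>i. gen (e i)) (rev (sorted_list_of_multiset M)))"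

lemma ordered_prod_empty: "ordered_prod {#} = 1"
  by (simp add: ordered_prod_def)

lemma ordered_prod_max:
  assumes "\<And>j. j \<in># M \<Longrightarrow> j \<le> i"
  shows "ordered_prod (add_mset i M) = gen (e i) * ordered_prod M"
proof -
  have "insort i (sorted_list_of_multiset M) = sorted_list_of_multiset M @ [i]"
    using assms by (intro sorted_insort_is_snoc) auto
  then show ?thesis by (simp add: ordered_prod_def)
qed

lemma ordered_prod_zero: "ordered_prod (add_mset 0 M) = ordered_prod M * gen (e 0)"
proof -
  have "insort 0 (sorted_list_of_multiset M) = 0 # sorted_list_of_multiset M"
    by (intro insort_is_Cons) auto
  then show ?thesis by (simp add: ordered_prod_def)
qed

interpretation FE: scalar_embedding "scalar :: 'k \<Rightarrow> 'g list \<Rightarrow>\<^sub>0 'k"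
  by unfold_locales (simp_all only: scalar_simps, rule scalar_mult_commute)

lemma scalar_left_commute: "p * (scalar c * q) = scalar c * (p * q)"
  for p :: "'g list \<Rightarrow>\<^sub>0 'k"
  by (metis scalar_mult_commute mult.assoc)

definition from_poly :: "'k sym_alg \<Rightarrow> 'g list \<Rightarrow>\<^sub>0 'k"
  where "from_poly = FE.lin_ext ordered_prod"

lemma from_poly_add: "from_poly (s + t) = from_poly s + from_poly t"
  and from_poly_zero: "from_poly 0 = 0"
  and from_poly_sum: "from_poly (sum f A) = (\<Sum>a\<in>A. from_poly (f a))"
  by (simp_all add: from_poly_def FE.lin_ext_add FE.lin_ext_zero FE.lin_ext_sum)

lemma from_poly_Mon: "from_poly (Mon M) = ordered_prod M"
  by (simp add: from_poly_def Mon_def FE.lin_ext_single scalar_simps)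

lemma from_poly_Cst: "from_poly (Cst c * s) = scalar c * from_poly s"
  unfolding from_poly_def Cst_def by (rule FE.lin_ext_scale)

lemma from_poly_mult_Var_0: "from_poly (s * Var 0) = from_poly s * gen (e 0)"
proof (induction s rule: poly_mapping_keys_induct)
  case (single M c)
  have "from_poly (Mon M * Var 0) = from_poly (Mon M) * gen (e 0)"
    by (simp add: mult.commute[of "Mon M"] from_poly_Mon ordered_prod_zero flip: Mon_add_mset)
  then show ?case
    by (simp add: single_eq_Cst_Mon from_poly_Cst mult.assoc)
qed (simp_all add: from_poly_zero from_poly_add distrib_right)

lemma gen_sum_ideal:
  "finite A \<Longrightarrow> gen (\<Sum>a\<in>A. scale (c a) (f a)) - (\<Sum>a\<in>A. scalar (c a) * gen (f a)) \<in> enveloping_ideal scale br"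
proof (induction A rule: finite_induct)
  case empty
  then show ?case by (simp add: gen_zero_ideal)
next
  case (insert a A)
  let ?r = "\<Sum>a\<in>A. scale (c a) (f a)"
  have "gen (scale (c a) (f a) + ?r) - (gen (scale (c a) (f a)) + gen ?r)
      + (gen (scale (c a) (f a)) - scalar (c a) * gen (f a))
      + (gen ?r - (\<Sum>a\<in>A. scalar (c a) * gen (f a))) \<in> enveloping_ideal scale br"
    by (intro ideal_add gen_add_ideal gen_scale_ideal insert.IH)
  then show ?case using insert.hyps by (simp add: algebra_simps)
qed

lemma gen_coord_ideal: "gen v - (\<Sum>k<n. scalar (coord v k) * gen (e k)) \<in> enveloping_ideal scale br"
  using gen_sum_ideal[of "{..<n}" "coord v" e] by (simp add: coord_sum)

text \<open>
  The action was defined by the relations of the enveloping algebra, so reading polynomials as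
  ordered products turns it into left multiplication. Hence every element of the enveloping
  algebra is a combination of ordered products.
\<close>

lemma from_poly_act: "gen (e i) * ordered_prod M - from_poly (act i M) \<in> enveloping_ideal scale br"
proof (induction "size M" arbitrary: i M rule: less_induct)
  case less
  show ?case
  proof (cases "\<forall>j\<in>#M. j \<le> i")
    case True
    then show ?thesis by (simp add: act_max from_poly_Mon ordered_prod_max ideal_zero)
  next
    case False
    define j where "j = Max_mset M"
    define N where "N = M - {#j#}"
    from False have "M \<noteq> {#}" by auto
    then have "j \<in># M" by (simp add: j_def)
    then have M: "M = add_mset j N" by (simp add: N_def)
    have N: "l \<le> j" if "l \<in># N" for l
      using that by (simp add: j_def N_def in_diffD)
    from False obtain l where l: "l \<in># M" "i < l" by (auto simp: not_le)
    then have "l \<le> j" by (simp add: j_def)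
    with l have ij: "i < j" by simp
    have IH: "gen (e k) * from_poly s - from_poly (op k s) \<in> enveloping_ideal scale br"
      if "deg_le (size N) s" for k s
    proof (induction s rule: poly_mapping_keys_induct)
      case (single P c)
      have "scalar c * (gen (e k) * ordered_prod P - from_poly (act k P)) \<in> enveloping_ideal scale br"
        using single that M by (intro ideal_mult_left less) (auto simp: deg_le_def less_Suc_eq_le)
      then show ?case
        by (simp add: single_eq_Cst_Mon from_poly_Cst linear_op_Cst[OF linear_op] from_poly_Mon op_Mon
            right_diff_distrib scalar_left_commute)
    next
      case (add q r)
      then show ?case
        using ideal_add[OF add] by (simp add: from_poly_add linear_op_add[OF linear_op] algebra_simps)
    qed (simp add: from_poly_zero linear_op_zero[OF linear_op] ideal_zero)
    define r where "r = act i N - Mon (add_mset i N)"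
    have r: "deg_le (size N) r"
      unfolding r_def by (rule deg_le_act_minus_leading)
    let ?b = "br (e i) (e j)"
    have lie: "gen v * from_poly (Mon N) - from_poly (lie_op v (Mon N)) \<in> enveloping_ideal scale br" for v
    proof -
      have "(gen v - (\<Sum>k<n. scalar (coord v k) * gen (e k))) * from_poly (Mon N)
         + (\<Sum>k<n. scalar (coord v k) * (gen (e k) * from_poly (Mon N) - from_poly (op k (Mon N))))
         \<in> enveloping_ideal scale br"
        by (intro ideal_add ideal_mult_right ideal_sum ideal_mult_left gen_coord_ideal IH deg_le_Mon order_refl)
      then show ?thesis
        by (simp add: lie_op_def from_poly_sum from_poly_Cst left_diff_distrib right_diff_distrib sum_subtractf
            sum_distrib_right mult.assoc)
    qed
    have lead: "gen (e j) * ordered_prod (add_mset i N) = from_poly (Mon (add_mset i (add_mset j N)))"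
      using N ij by (subst ordered_prod_max[symmetric]) (auto simp: from_poly_Mon add_mset_commute)
    have act_i_N: "act i N = Mon (add_mset i N) + r" by (simp add: r_def)
    have jN: "ordered_prod (add_mset j N) = gen (e j) * ordered_prod N"
      by (rule ordered_prod_max) (rule N)
    have act_M: "act i (add_mset j N) = Mon (add_mset i (add_mset j N)) + op j r + lie_op ?b (Mon N)"
      unfolding r_def by (rule act_less[OF N ij])
    have "(gen (e i) * gen (e j) - gen (e j) * gen (e i) - gen ?b) * ordered_prod N
        + gen (e j) * (gen (e i) * from_poly (Mon N) - from_poly (op i (Mon N)))
        + (gen (e j) * from_poly r - from_poly (op j r))
        + (gen ?b * from_poly (Mon N) - from_poly (lie_op ?b (Mon N))) \<in> enveloping_ideal scale br"
      by (intro ideal_add ideal_mult_right ideal_mult_left gen_br_ideal IH lie r deg_le_Mon order_refl)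
    also have "(gen (e i) * gen (e j) - gen (e j) * gen (e i) - gen ?b) * ordered_prod N
        + gen (e j) * (gen (e i) * from_poly (Mon N) - from_poly (op i (Mon N)))
        + (gen (e j) * from_poly r - from_poly (op j r))
        + (gen ?b * from_poly (Mon N) - from_poly (lie_op ?b (Mon N)))
      = gen (e i) * ordered_prod M - from_poly (act i M)"
      unfolding M unfolding act_M jN
      by (simp add: op_Mon act_i_N from_poly_add from_poly_Mon distrib_left right_diff_distrib left_diff_distrib
          mult.assoc lead)
    finally show ?thesis .
  qed
qed

lemma from_poly_op: "gen (e k) * from_poly s - from_poly (op k s) \<in> enveloping_ideal scale br"
proof (induction s rule: poly_mapping_keys_induct)
  case (single P c)
  have "scalar c * (gen (e k) * ordered_prod P - from_poly (act k P)) \<in> enveloping_ideal scale br"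
    by (intro ideal_mult_left from_poly_act)
  then show ?case
    by (simp add: single_eq_Cst_Mon from_poly_Cst linear_op_Cst[OF linear_op] from_poly_Mon op_Mon
       right_diff_distrib scalar_left_commute)
next
  case (add q r)
  then show ?case
    using ideal_add[OF add] by (simp add: from_poly_add linear_op_add[OF linear_op] algebra_simps)
qed (simp add: from_poly_zero linear_op_zero[OF linear_op] ideal_zero)

lemma from_poly_lie_op: "gen v * from_poly s - from_poly (lie_op v s) \<in> enveloping_ideal scale br"
proof -
  have "(gen v - (\<Sum>k<n. scalar (coord v k) * gen (e k))) * from_poly s
     + (\<Sum>k<n. scalar (coord v k) * (gen (e k) * from_poly s - from_poly (op k s)))
     \<in> enveloping_ideal scale br"
    by (intro ideal_add ideal_mult_right ideal_sum ideal_mult_left gen_coord_ideal from_poly_op)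
  then show ?thesis
    by (simp add: lie_op_def from_poly_sum from_poly_Cst left_diff_distrib right_diff_distrib sum_subtractf
        sum_distrib_right mult.assoc)
qed

lemma from_poly_word_op: "Poly_Mapping.single w 1 * from_poly s - from_poly (word_op w s) \<in> enveloping_ideal scale br"
proof (induction w)
  case Nil
  have "Poly_Mapping.single ([] :: 'g list) (1::'k) = 1"
    by (metis single_one zero_list_def)
  then show ?case
    by (simp add: word_op_def ideal_zero)
next
  case (Cons v w)
  have "Poly_Mapping.single (v # w) (1::'k) = gen v * Poly_Mapping.single w 1"
    by (simp add: gen_def mult_single plus_list_def)
  moreover have "gen v * (Poly_Mapping.single w 1 * from_poly s - from_poly (word_op w s))
     + (gen v * from_poly (word_op w s) - from_poly (lie_op v (word_op w s))) \<in> enveloping_ideal scale br"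
    by (intro ideal_add ideal_mult_left Cons.IH from_poly_lie_op)
  ultimately show ?case
    by (simp add: word_op_def right_diff_distrib mult.assoc)
qed

lemma from_poly_rho: "p * from_poly s - from_poly (rho p s) \<in> enveloping_ideal scale br"
proof (induction p rule: poly_mapping_keys_induct)
  case (single w c)
  have "Poly_Mapping.single w c = scalar c * Poly_Mapping.single w 1"
    by (simp add: scalar_def mult_single plus_list_def)
  then show ?case
    using ideal_mult_left[OF from_poly_word_op[of w s], of "scalar c"]
    unfolding rho_single from_poly_Cst by (simp add: right_diff_distrib mult.assoc)
next
  case (add q r)
  then show ?case
    using ideal_add[OF add] by (simp add: from_poly_add rho_add algebra_simps)
qed (simp add: from_poly_zero rho_zero ideal_zero)

text \<open>
  An element of the enveloping algebra is recovered from its action on the polynomial \<open>1\<close>. This is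
  the Poincare-Birkhoff-Witt theorem in the form that \<open>U\<close> embeds into the polynomial ring.
\<close>

lemma from_poly_to_poly: "p - from_poly (to_poly p) \<in> enveloping_ideal scale br"
  using from_poly_rho[of p 1] by (simp add: to_poly_def flip: Mon_empty) (simp add: from_poly_Mon ordered_prod_empty)

lemma to_poly_eq_0_iff: "to_poly p = 0 \<longleftrightarrow> p \<in> enveloping_ideal scale br"
proof
  assume "to_poly p = 0"
  then show "p \<in> enveloping_ideal scale br" using from_poly_to_poly[of p] by (simp add: from_poly_zero)
next
  assume "p \<in> enveloping_ideal scale br"
  then show "to_poly p = 0" by (simp add: to_poly_def rho_enveloping_ideal)
qed

lemma to_poly_eq_iff: "to_poly p = to_poly q \<longleftrightarrow> p - q \<in> enveloping_ideal scale br"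
  using to_poly_eq_0_iff[of "p - q"] by (simp add: to_poly_diff)

section \<open>Right multiplication on the polynomial side\<close>

text \<open>
  Applying \<^const>\<open>op\<close> for increasing indices builds up all monomials from \<open>1\<close>, so the polynomial
  ring is a cyclic module, and a linear map that respects these building steps is an endomorphism of
  it: the bracket relation reduces every other product to such steps. Right multiplications by
  elements of \<open>U\<close> commute with the left action; below they are identified by exhibiting
  endomorphisms with the right value at \<open>1\<close>.
\<close>

lemma endomorphism_commutes_op:
  assumes lin: "linear_op R"
    and max: "\<And>j M. (\<And>i. i \<in># M \<Longrightarrow> i \<le> j) \<Longrightarrow> op j (R (Mon M)) = R (Mon (add_mset j M))"
  shows "op i (R s) = R (op i s)"
proof -
  have Mon: "op i (R (Mon M)) = R (op i (Mon M))" for i M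
  proof (induction "size M" arbitrary: i M rule: less_induct)
    case less
    show ?case
    proof (cases "\<forall>j\<in>#M. j \<le> i")
      case True
      then show ?thesis by (simp add: max op_max)
    next
      case False
      define j where "j = Max_mset M"
      define N where "N = M - {#j#}"
      from False have "M \<noteq> {#}" by auto
      then have "j \<in># M" by (simp add: j_def)
      then have M: "M = add_mset j N" by (simp add: N_def)
      have N: "l \<le> j" if "l \<in># N" for l
        using that by (simp add: j_def N_def in_diffD)
      from False obtain l where l: "l \<in># M" "i < l" by (auto simp: not_le)
      then have "l \<le> j" by (simp add: j_def)
      with l have ij: "i < j" by simp
      have IH: "op k (R s) = R (op k s)" if "deg_le (size N) s" for k s
      proof (rule linear_op_eqI[where p = s, OF linear_op_compose[OF linear_op lin]
            linear_op_compose[OF lin linear_op]])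
        show "op k (R (Mon P)) = R (op k (Mon P))" if "P \<in> Poly_Mapping.keys s" for P
          using that \<open>deg_le (size N) s\<close> M by (intro less) (auto simp: deg_le_def less_Suc_eq_le)
      qed
      have dN: "deg_le (size N) (Mon N)" by (simp add: deg_le_Mon)
      define r where "r = op i (Mon N) - Mon (add_mset i N)"
      have r: "deg_le (size N) r"
        unfolding r_def op_Mon by (rule deg_le_act_minus_leading)
      have lead: "op i (Mon N) = Mon (add_mset i N) + r" by (simp add: r_def)
      have lie: "lie_op v (R (Mon N)) = R (lie_op v (Mon N))" for v
        by (simp add: lie_op_def IH[OF dN] linear_op_sum[OF lin] linear_op_Cst[OF lin])
      have ijN: "op j (R (Mon (add_mset i N))) = R (op j (Mon (add_mset i N)))"
      proof -
        have le: "l \<le> j" if "l \<in># add_mset i N" for l using N ij that by auto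
        have "op j (R (Mon (add_mset i N))) = R (Mon (add_mset j (add_mset i N)))"
          by (rule max) (rule le)
        moreover have "op j (Mon (add_mset i N)) = Mon (add_mset j (add_mset i N))"
          by (rule op_max) (rule le)
        ultimately show ?thesis by simp
      qed
      have jN: "R (Mon M) = op j (R (Mon N))"
        unfolding M by (rule max[symmetric]) (rule N)
      have jN': "Mon M = op j (Mon N)"
        unfolding M by (rule op_max[symmetric]) (rule N)
      have "op i (R (Mon M)) = op j (op i (R (Mon N))) + lie_op (br (e i) (e j)) (R (Mon N))"
        unfolding jN by (rule op_bracket)
      also have "\<dots> = R (op j (op i (Mon N)) + lie_op (br (e i) (e j)) (Mon N))"
        by (simp add: IH[OF dN] lie lead linear_op_add[OF linear_op] linear_op_add[OF lin] ijN IH[OF r])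
      also have "op j (op i (Mon N)) + lie_op (br (e i) (e j)) (Mon N) = op i (Mon M)"
        unfolding jN' by (rule op_bracket[symmetric])
      finally show ?thesis .
    qed
  qed
  show ?thesis
    by (rule linear_op_eqI[where p = s, OF linear_op_compose[OF linear_op lin]
        linear_op_compose[OF lin linear_op] Mon])
qed

lemma endomorphism_commutes_rho:
  assumes lin: "linear_op R"
    and max: "\<And>j M. (\<And>i. i \<in># M \<Longrightarrow> i \<le> j) \<Longrightarrow> op j (R (Mon M)) = R (Mon (add_mset j M))"
  shows "rho p (R s) = R (rho p s)"
proof -
  have lie: "lie_op v (R s) = R (lie_op v s)" for v s
    by (simp add: lie_op_def endomorphism_commutes_op[OF assms] linear_op_sum[OF lin]
        linear_op_Cst[OF lin])
  have word: "word_op w (R s) = R (word_op w s)" for w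
    by (induction w) (simp_all add: word_op_def lie)
  show ?thesis
    by (simp add: rho_def SE.lin_ext_def word linear_op_sum[OF lin] linear_op_Cst[OF lin])
qed

lemma rho_mult_Var_0: "rho p (s * Var 0) = rho p s * Var 0"
proof (rule endomorphism_commutes_rho)
  show "linear_op (\<lambda>s. s * Var 0)"
    by (rule linear_op_times[OF linear_op_id])
  fix j :: nat and M assume "\<And>i. i \<in># M \<Longrightarrow> i \<le> j"
  then have "op j (Mon (add_mset 0 M)) = Mon (add_mset j (add_mset 0 M))"
    by (intro op_max) auto
  then show "op j (Mon M * Var 0) = Mon (add_mset j M) * Var 0"
    by (simp add: Mon_add_mset mult_ac)
qed

lemma to_poly_mult_e_0: "0 < n \<Longrightarrow> to_poly (p * gen (e 0)) = to_poly p * Var 0"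
  using rho_mult_Var_0[of p 1] op_max[of "{#}" 0]
  by (simp add: to_poly_def rho_mult rho_gen lie_op_e Mon_empty Var_def)

lemma to_poly_mult_scalar: "to_poly (p * scalar c) = to_poly p * Cst c"
  using linear_op_Cst[OF linear_rho, of p c 1] by (simp add: to_poly_def rho_mult rho_scalar mult.commute)

end

text \<open>
  A polynomial in all variables as a polynomial in the variable \<open>0\<close> with coefficients in the
  polynomial ring; substitution for the variable \<open>0\<close> becomes evaluation.
\<close>

interpretation PE: scalar_embedding "\<lambda>c. [:Cst c:]"
  by unfold_locales (simp_all add: Cst_simps one_pCons mult.commute)

definition poly_in_0 :: "'k::field sym_alg \<Rightarrow> 'k sym_alg poly"
  where "poly_in_0 = PE.lin_ext (\<lambda>M. Polynomial.monom (Mon (filter_mset (\<lambda>i. i \<noteq> 0) M)) (count M 0))"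

definition subst0 :: "'k::field sym_alg \<Rightarrow> 'k sym_alg \<Rightarrow> 'k sym_alg"
  where "subst0 a s = poly (poly_in_0 s) a"

lemma poly_in_0_add: "poly_in_0 (s + t) = poly_in_0 s + poly_in_0 t"
  and poly_in_0_zero: "poly_in_0 0 = 0"
  by (simp_all add: poly_in_0_def PE.lin_ext_add PE.lin_ext_zero)

lemma poly_in_0_Cst: "poly_in_0 (Cst c) = [:Cst c:]"
proof -
  have "poly_in_0 (Poly_Mapping.single {#} c) = [:Cst c:]"
    unfolding poly_in_0_def PE.lin_ext_single by (simp add: Mon_empty)
  then show ?thesis by (simp add: Cst_def)
qed

lemma poly_in_0_mult: "poly_in_0 (s * t) = poly_in_0 s * poly_in_0 t"
  unfolding poly_in_0_def by (rule PE.lin_ext_mult) (simp add: mult_monom Mon_add)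

lemma poly_in_0_Mon: "poly_in_0 (Mon M) = Polynomial.monom (Mon (filter_mset (\<lambda>i. i \<noteq> 0) M)) (count M 0)"
  by (simp add: poly_in_0_def Mon_def PE.lin_ext_single Cst_simps flip: one_pCons)

lemma poly_in_0_Var: "poly_in_0 (Var i) = (if i = 0 then [:0, 1:] else [:Var i:])"
  by (simp add: Var_def poly_in_0_Mon Mon_empty monom_0 monom_Suc)

lemma subst0_simps:
  fixes a :: "'a::field sym_alg"
  shows
  "subst0 a (s + t) = subst0 a s + subst0 a t" "subst0 a (s * t) = subst0 a s * subst0 a t"
  "subst0 a (Cst c) = Cst c" "subst0 a 0 = 0" "subst0 a 1 = 1"
  "subst0 a (Var i) = (if i = 0 then a else Var i)"
proof -
  have "poly_in_0 1 = (1 :: 'a sym_alg poly)"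
    using poly_in_0_Cst[of "1 :: 'a"] by (simp add: Cst_simps flip: one_pCons)
  then show "subst0 a 1 = 1" by (simp add: subst0_def)
qed (simp_all add: subst0_def poly_in_0_add poly_in_0_mult poly_in_0_Cst poly_in_0_zero poly_in_0_Var)

lemma subst0_Mon: "subst0 a (Mon M) = Mon (filter_mset (\<lambda>i. i \<noteq> 0) M) * a ^ count M 0"
  by (simp add: subst0_def poly_in_0_Mon poly_monom)

lemma subst0_power: "subst0 a (s ^ k) = subst0 a s ^ k"
  by (induction k) (simp_all add: subst0_simps)

lemma linear_subst0: "linear_op (subst0 a)"
  by (simp add: linear_op_def subst0_simps)

lemma subst0_subst0: "subst0 a (subst0 b s) = subst0 (subst0 a b) s"
proof (rule linear_op_eqI[where p = s, OF linear_op_compose[OF linear_subst0 linear_subst0]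
      linear_subst0])
  fix M :: "nat multiset"
  show "subst0 a (subst0 b (Mon M)) = subst0 (subst0 a b) (Mon M)"
    by (simp add: subst0_Mon subst0_simps subst0_power filter_filter_mset)
qed

lemma subst0_Var_0: "subst0 (Var 0) s = s"
proof (rule linear_op_eqI[where p = s, OF linear_subst0 linear_op_id])
  fix M :: "nat multiset"
  have "Mon {#i \<in># M. i = 0#} = (Var 0 ^ count M 0 :: 'a sym_alg)"
    by (induction M) (auto simp: Mon_empty Mon_add_mset)
  moreover have "Mon (filter_mset (\<lambda>i. i \<noteq> 0) M) * Mon {#i \<in># M. i = 0#} = (Mon M :: 'a sym_alg)"
  proof -
    have "Mon (filter_mset (\<lambda>i. i \<noteq> 0) M) * Mon {#i \<in># M. i = 0#}
        = (Mon (filter_mset (\<lambda>i. i \<noteq> 0) M + {#i \<in># M. \<not> i \<noteq> 0#}) :: 'a sym_alg)"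
      by (simp only: Mon_add not_not)
    then show ?thesis by (simp only: multiset_partition[symmetric])
  qed
  ultimately show "subst0 (Var 0) (Mon M) = (Mon M :: 'a sym_alg)"
    by (simp add: subst0_Mon)
qed

lemma poly_in_0_eq_0_iff: "poly_in_0 s = 0 \<longleftrightarrow> s = 0"
  using subst0_Var_0[of s] by (auto simp: subst0_def poly_in_0_zero)

lemma minus_subst0_dvd: "Var 0 - a dvd s - subst0 a s"
proof -
  have "poly (poly_in_0 s - [:subst0 a s:]) a = 0" by (simp add: subst0_def)
  then obtain q where q: "poly_in_0 s - [:subst0 a s:] = [:- a, 1:] * q"
    by (metis poly_eq_0_iff_dvd dvdE)
  have "s - subst0 a s = poly (poly_in_0 s - [:subst0 a s:]) (Var 0)"
    using subst0_Var_0[of s] by (simp add: subst0_def)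
  also have "\<dots> = (Var 0 - a) * poly q (Var 0)"
    unfolding q by (simp add: left_diff_distrib)
  finally show ?thesis by simp
qed

lemma Var_neq_Cst: "Var i + Cst c \<noteq> 0"
proof -
  have "Poly_Mapping.lookup (Var i + Cst c) {#i#} = 1"
    by (simp add: Var_def Mon_def Cst_def lookup_add lookup_single)
  then show ?thesis by auto
qed

lemma Cst_inject: "Cst a = Cst b \<longleftrightarrow> a = b"
  by (metis Cst_def lookup_single_eq)

definition letters_le :: "nat \<Rightarrow> 'k::field sym_alg \<Rightarrow> bool"
  where "letters_le j s \<longleftrightarrow> (\<forall>M\<in>Poly_Mapping.keys s. \<forall>i\<in>#M. i \<le> j)"

lemma letters_le_add: "letters_le j s \<Longrightarrow> letters_le j t \<Longrightarrow> letters_le j (s + t)"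
  using keys_add[of s t] by (auto simp: letters_le_def)

lemma letters_le_mult: "letters_le j s \<Longrightarrow> letters_le j t \<Longrightarrow> letters_le j (s * t)"
  using keys_mult[of s t] by (fastforce simp: letters_le_def)

lemma letters_le_Mon: "(\<And>i. i \<in># M \<Longrightarrow> i \<le> j) \<Longrightarrow> letters_le j (Mon M)"
  by (simp add: letters_le_def Mon_def)

lemma letters_le_Var: "i \<le> j \<Longrightarrow> letters_le j (Var i)"
  unfolding Var_def by (rule letters_le_Mon) auto

lemma letters_le_Cst: "letters_le j (Cst c)"
  by (auto simp: letters_le_def Cst_def)

lemma letters_le_power: "letters_le j s \<Longrightarrow> letters_le j (s ^ k)"
proof (induction k)
  case 0
  then show ?case using letters_le_Cst[of j 1] by (simp add: Cst_simps)
qed (simp add: letters_le_mult)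

lemma (in lie_basis) op_letters_le:
  assumes "letters_le j s"
  shows "op j s = Var j * s"
proof (rule linear_op_eqI[where p = s, OF linear_op linear_op_mult_left[OF linear_op_id]])
  fix M assume "M \<in> Poly_Mapping.keys s"
  then show "op j (Mon M) = Var j * Mon M"
    using assms by (subst op_max) (auto simp: letters_le_def Mon_add_mset)
qed

text \<open>
  The situation of both cases of the theorem: \<open>x = e 0 + \<mu>\<close>, and \<open>e 1\<close> is an eigenvector of
  \<open>ad (e 0)\<close>. Moving \<open>e 0\<close> to the right across \<open>e 1\<close> shifts it by the eigenvalue \<open>lam\<close>.
\<close>

locale lie_basis_eigen = lie_basis scale br n e coord
  for scale :: "'k::field_char_0 \<Rightarrow> 'g::ab_group_add \<Rightarrow> 'g" and br n e coord +
  fixes lam :: 'k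
  assumes n: "1 < n" and br_01: "br (e 0) (e 1) = scale lam (e 1)"
begin

lemma rho_mult_Var_1:
  "rho p (subst0 (Var 0 + Cst lam) s * Var 1) = subst0 (Var 0 + Cst lam) (rho p s) * Var 1"
proof (rule endomorphism_commutes_rho)
  let ?b = "Var 0 + Cst lam"
  show "linear_op (\<lambda>s. subst0 ?b s * Var 1)"
    by (rule linear_op_times[OF linear_subst0])
  fix j :: nat and M assume M: "\<And>i. i \<in># M \<Longrightarrow> i \<le> j"
  have letters_b: "letters_le j (subst0 ?b (Mon M))"
    unfolding subst0_Mon
    by (intro letters_le_mult letters_le_power letters_le_add letters_le_Var letters_le_Cst letters_le_Mon)
      (auto simp: M)
  show "op j (subst0 ?b (Mon M) * Var 1) = subst0 ?b (Mon (add_mset j M)) * Var 1"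
  proof (cases "j = 0")
    case False
    then have "letters_le j (subst0 ?b (Mon M) * Var 1)"
      by (intro letters_le_mult letters_b letters_le_Var) simp
    then show ?thesis
      using False by (simp add: op_letters_le Mon_add_mset subst0_simps mult.assoc)
  next
    case True
    define q where "q = subst0 ?b (Mon M)"
    have q0: "letters_le 0 q" using letters_b True by (simp add: q_def)
    have le1: "letters_le 1 s" if "letters_le 0 s" for s :: "'k sym_alg"
      using that by (force simp: letters_le_def)
    have "q * Var 1 = op 1 q"
      using op_letters_le[OF le1[OF q0]] by (simp add: mult.commute)
    then have "op 0 (q * Var 1) = op 1 (op 0 q) + Cst lam * op 1 q"
      using n by (simp add: op_bracket[of 0 1] br_01 lie_op_scale lie_op_e del: One_nat_def)
    also have "\<dots> = Var 1 * (Var 0 * q) + Cst lam * (Var 1 * q)"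
      using letters_le_mult[OF letters_le_Var[of 0 0] q0]
      by (simp add: op_letters_le[OF le1] op_letters_le[OF q0] q0 del: One_nat_def)
    also have "\<dots> = subst0 ?b (Mon (add_mset 0 M)) * Var 1"
      by (simp add: Mon_add_mset subst0_simps q_def algebra_simps)
    finally show ?thesis using True by (simp add: q_def)
  qed
qed

lemma to_poly_mult_e_1: "to_poly (p * gen (e 1)) = subst0 (Var 0 + Cst lam) (to_poly p) * Var 1"
  using rho_mult_Var_1[of p 1] op_max[of "{#}" 1] n
  by (simp add: to_poly_def rho_mult rho_gen lie_op_e Mon_empty Var_def subst0_simps)

lemma to_poly_mult_e_1_power:
  "to_poly (p * gen (e 1) ^ m) = subst0 (Var 0 + Cst (of_nat m * lam)) (to_poly p) * Var 1 ^ m"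
proof (induction m)
  case 0
  show ?case by (simp add: Cst_simps subst0_Var_0)
next
  case (Suc m)
  have "to_poly (p * gen (e 1) ^ Suc m) = to_poly ((p * gen (e 1) ^ m) * gen (e 1))"
    by (simp only: power_Suc2 mult.assoc)
  also have "\<dots> = subst0 (Var 0 + Cst (of_nat (Suc m) * lam)) (to_poly p) * Var 1 ^ Suc m"
    unfolding to_poly_mult_e_1 Suc.IH
    by (simp add: subst0_simps subst0_subst0 subst0_power Cst_simps algebra_simps)
  finally show ?case .
qed

lemma to_poly_mult_x: "to_poly (p * (gen (e 0) + scalar \<mu>)) = to_poly p * (Var 0 + Cst \<mu>)"
  using n by (simp add: distrib_left to_poly_add to_poly_mult_e_0 to_poly_mult_scalar)

text \<open>Substituting \<open>- \<mu>\<close> for the variable \<open>0\<close> kills \<open>U x\<close>, and the variable \<open>1\<close> can be cancelled.\<close>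

lemma subst0_to_poly_eq_0:
  assumes "u * gen (e 1) ^ m - h * (gen (e 0) + scalar \<mu>) \<in> enveloping_ideal scale br"
  shows "subst0 (Cst (of_nat m * lam - \<mu>)) (to_poly u) = 0"
proof -
  let ?a = "Cst (- \<mu>)"
  have "subst0 (Var 0 + Cst (of_nat m * lam)) (to_poly u) * Var 1 ^ m = to_poly h * (Var 0 + Cst \<mu>)"
    using to_poly_cong[OF assms] unfolding to_poly_mult_e_1_power to_poly_mult_x .
  then have "subst0 ?a (subst0 (Var 0 + Cst (of_nat m * lam)) (to_poly u) * Var 1 ^ m)
      = subst0 ?a (to_poly h * (Var 0 + Cst \<mu>))"
    by (simp only:)
  then have "subst0 ?a (subst0 (Var 0 + Cst (of_nat m * lam)) (to_poly u)) * Var 1 ^ m = 0"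
    by (simp add: subst0_simps(2) subst0_power) (simp add: subst0_simps Cst_simps)
  moreover have "(Var 1 :: 'k sym_alg) \<noteq> 0"
    using Var_neq_Cst[of 1 0] by (simp add: Cst_simps)
  moreover have "?a + Cst (of_nat m * lam) = Cst (of_nat m * lam - \<mu>)"
    by (simp add: Cst_simps)
  ultimately show ?thesis
    by (simp add: subst0_subst0 subst0_simps)
qed

text \<open>
  If \<open>lam \<noteq> 0\<close>, an annihilator \<open>u\<close> of \<open>U / U x\<close> satisfies \<open>u e\<^sub>1\<^sup>m \<in> U x\<close> for all \<open>m\<close>, which by the
  shift gives infinitely many roots of one polynomial.
\<close>

theorem faithful_eigen:
  assumes "lam \<noteq> 0"
    and ann: "\<And>v. \<exists>h. u * v - h * (gen (e 0) + scalar \<mu>) \<in> enveloping_ideal scale br"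
  shows "u \<in> enveloping_ideal scale br"
proof -
  have "poly (poly_in_0 (to_poly u)) (Cst (of_nat m * lam - \<mu>)) = 0" for m :: nat
    using ann[of "gen (e 1) ^ m"] subst0_to_poly_eq_0 by (auto simp: subst0_def)
  then have "range (\<lambda>m::nat. Cst (of_nat m * lam - \<mu>)) \<subseteq> {a. poly (poly_in_0 (to_poly u)) a = 0}"
    by auto
  moreover have "inj (\<lambda>m::nat. Cst (of_nat m * lam - \<mu>))"
    using \<open>lam \<noteq> 0\<close> by (intro injI) (simp add: Cst_inject)
  then have "infinite (range (\<lambda>m::nat. Cst (of_nat m * lam - \<mu>)))"
    by (simp add: range_inj_infinite)
  ultimately have "poly_in_0 (to_poly u) = 0"
    using poly_roots_finite finite_subset by blast
  then show ?thesis by (simp add: poly_in_0_eq_0_iff to_poly_eq_0_iff)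
qed

end

section \<open>Locally nilpotent inner derivations\<close>

context lie_algebra
begin

definition inner :: "'g \<Rightarrow> ('g list \<Rightarrow>\<^sub>0 'k) \<Rightarrow> ('g list \<Rightarrow>\<^sub>0 'k)"
  where "inner y p = gen y * p - p * gen y"

lemma inner_add: "inner y (p + q) = inner y p + inner y q"
  and inner_diff: "inner y (p - q) = inner y p - inner y q"
  by (simp_all add: inner_def algebra_simps)

lemma inner_pow_add: "(inner y ^^ m) (p + q) = (inner y ^^ m) p + (inner y ^^ m) q"
  by (induction m) (simp_all add: inner_add)

lemma inner_ideal: "p \<in> enveloping_ideal scale br \<Longrightarrow> inner y p \<in> enveloping_ideal scale br"
  by (simp add: inner_def ideal_diff ideal_mult_left ideal_mult_right)

lemma inner_pow_ideal:
  "p \<in> enveloping_ideal scale br \<Longrightarrow> (inner y ^^ m) p \<in> enveloping_ideal scale br"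
  by (induction m) (simp_all add: inner_ideal)

lemma inner_pow_mono:
  assumes "(inner y ^^ m) p \<in> enveloping_ideal scale br" "m \<le> m'"
  shows "(inner y ^^ m') p \<in> enveloping_ideal scale br"
proof -
  have "(inner y ^^ (m' - m + m)) p \<in> enveloping_ideal scale br"
    unfolding funpow_add comp_apply by (intro inner_pow_ideal assms(1))
  then show ?thesis using assms(2) by simp
qed

lemma inner_mult: "inner y (p * q) = inner y p * q + p * inner y q"
  by (simp add: inner_def algebra_simps)

lemma inner_pow_mult:
  assumes "(inner y ^^ m) p \<in> enveloping_ideal scale br" "(inner y ^^ k) q \<in> enveloping_ideal scale br"
  shows "(inner y ^^ (m + k)) (p * q) \<in> enveloping_ideal scale br"
  using assms
proof (induction "m + k" arbitrary: m k p q)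
  case 0
  then show ?case by (simp add: ideal_mult_left)
next
  case (Suc l)
  show ?case
  proof (cases "m = 0 \<or> k = 0")
    case True
    then have "p * q \<in> enveloping_ideal scale br"
      using Suc.prems by (auto simp: ideal_mult_left ideal_mult_right)
    then show ?thesis by (rule inner_pow_ideal)
  next
    case False
    then obtain m' k' where mk: "m = Suc m'" "k = Suc k'" by (auto simp: gr0_conv_Suc)
    have 1: "(inner y ^^ (m' + k)) (inner y p * q) \<in> enveloping_ideal scale br"
      using Suc.prems Suc.hyps(2) mk by (intro Suc.hyps(1)) (auto simp: funpow_swap1)
    have 2: "(inner y ^^ (m + k')) (p * inner y q) \<in> enveloping_ideal scale br"
      using Suc.prems Suc.hyps(2) mk by (intro Suc.hyps(1)) (auto simp: funpow_swap1)
    have "(inner y ^^ (m + k)) (p * q) = (inner y ^^ (m' + k)) (inner y (p * q))"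
      by (simp add: mk funpow_swap1)
    also have "\<dots> = (inner y ^^ (m' + k)) (inner y p * q) + (inner y ^^ (m + k')) (p * inner y q)"
      by (simp add: inner_mult inner_pow_add inner_add mk)
    finally show ?thesis using ideal_add[OF 1 2] by simp
  qed
qed

lemma inner_pow_gen: "(inner y ^^ m) (gen v) - gen ((br y ^^ m) v) \<in> enveloping_ideal scale br"
proof (induction m)
  case 0
  then show ?case by (simp add: ideal_zero)
next
  case (Suc m)
  have "inner y ((inner y ^^ m) (gen v) - gen ((br y ^^ m) v))
    + (gen y * gen ((br y ^^ m) v) - gen ((br y ^^ m) v) * gen y - gen (br y ((br y ^^ m) v)))
    \<in> enveloping_ideal scale br"
    by (intro ideal_add inner_ideal Suc gen_br_ideal)
  then show ?case by (simp add: inner_diff) (simp add: inner_def[of y "gen _"])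
qed

text \<open>
  A derivation that is nilpotent on every generator is nilpotent on every element, though in
  general with unbounded exponents.
\<close>

lemma inner_locally_nilpotent:
  assumes "ad_nilpotent br y"
  shows "\<exists>m. (inner y ^^ m) p \<in> enveloping_ideal scale br"
proof (induction p rule: poly_mapping_keys_induct)
  case zero
  show ?case by (rule exI[of _ 0]) (simp add: ideal_zero)
next
  case (single w c)
  show ?case
  proof (induction w)
    case Nil
    have "inner y (scalar c) = 0"
      by (simp add: inner_def scalar_mult_commute)
    then have "(inner y ^^ 1) (Poly_Mapping.single [] c) \<in> enveloping_ideal scale br"
      by (simp add: scalar_def ideal_zero)
    then show ?case by blast
  next
    case (Cons v w)
    from assms obtain m where "(br y ^^ m) v = 0" by (auto simp: ad_nilpotent_def)
    then have "(inner y ^^ m) (gen v) \<in> enveloping_ideal scale br"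
      using ideal_add[OF inner_pow_gen[where m = m and y = y and v = v] gen_zero_ideal] by simp
    moreover obtain k where "(inner y ^^ k) (Poly_Mapping.single w c) \<in> enveloping_ideal scale br"
      using Cons by blast
    moreover have "Poly_Mapping.single (v # w) c = gen v * Poly_Mapping.single w c"
      by (simp add: gen_def mult_single plus_list_def)
    ultimately show ?case using inner_pow_mult by metis
  qed
next
  case (add q r)
  then obtain k m where "(inner y ^^ k) q \<in> enveloping_ideal scale br"
    "(inner y ^^ m) r \<in> enveloping_ideal scale br" by blast
  then have "(inner y ^^ (max k m)) q \<in> enveloping_ideal scale br"
    "(inner y ^^ (max k m)) r \<in> enveloping_ideal scale br"
    using inner_pow_mono by (metis max.cobounded1 max.cobounded2)+
  then show ?case using ideal_add by (metis inner_pow_add)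
qed

text \<open>
  Hence a nonzero subspace of \<open>U\<close> that is stable under such a derivation contains a nonzero
  element that the derivation kills.
\<close>

lemma inner_kernel_element:
  assumes "ad_nilpotent br y" and "u \<notin> enveloping_ideal scale br"
  obtains m where "(inner y ^^ m) u \<notin> enveloping_ideal scale br"
    "inner y ((inner y ^^ m) u) \<in> enveloping_ideal scale br"
proof -
  define l where "l = (LEAST l. (inner y ^^ l) u \<in> enveloping_ideal scale br)"
  obtain l0 where "(inner y ^^ l0) u \<in> enveloping_ideal scale br"
    using inner_locally_nilpotent[OF assms(1)] by blast
  then have l: "(inner y ^^ l) u \<in> enveloping_ideal scale br"
    unfolding l_def by (rule LeastI)
  with assms(2) obtain m where m: "l = Suc m" by (cases l) auto
  have "(inner y ^^ m) u \<notin> enveloping_ideal scale br"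
    using not_less_Least[of m "\<lambda>l. (inner y ^^ l) u \<in> enveloping_ideal scale br"] m
    by (simp add: l_def)
  then show ?thesis using that[of m] l m by simp
qed

end

section \<open>The case of a commuting bracket\<close>

context lie_basis_eigen
begin

lemma right_cancel_x:
  assumes "a * (gen (e 0) + scalar \<mu>) - b * (gen (e 0) + scalar \<mu>) \<in> enveloping_ideal scale br"
  shows "a - b \<in> enveloping_ideal scale br"
proof -
  have "to_poly a * (Var 0 + Cst \<mu>) = to_poly b * (Var 0 + Cst \<mu>)"
    using to_poly_cong[OF assms] by (simp only: to_poly_mult_x)
  then show ?thesis by (simp add: Var_neq_Cst to_poly_eq_iff)
qed

lemma right_cancel_x_power:
  assumes "a * (gen (e 0) + scalar \<mu>) ^ k \<in> enveloping_ideal scale br"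
  shows "a \<in> enveloping_ideal scale br"
  using assms
proof (induction k)
  case (Suc k)
  have "a * (gen (e 0) + scalar \<mu>) ^ k - 0 \<in> enveloping_ideal scale br"
    by (rule right_cancel_x[of _ \<mu>]) (use Suc.prems in \<open>simp add: power_commutes mult.assoc\<close>)
  then show ?case using Suc.IH by simp
qed simp

lemma to_poly_mult_x_power:
  "to_poly (p * (gen (e 0) + scalar \<mu>) ^ k) = to_poly p * (Var 0 + Cst \<mu>) ^ k"
  by (induction k) (simp_all only: power_Suc2 power_0 mult_1_right mult.assoc[symmetric] to_poly_mult_x)

text \<open>A right multiple of \<open>x\<^sup>k\<close> has degree at least \<open>k\<close> in the variable \<open>0\<close>, unless it vanishes.\<close>

lemma right_multiples_of_all_powers:
  assumes "\<And>k. \<exists>v. u - v * (gen (e 0) + scalar \<mu>) ^ k \<in> enveloping_ideal scale br"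
  shows "u \<in> enveloping_ideal scale br"
proof (rule ccontr)
  assume u: "u \<notin> enveloping_ideal scale br"
  define k where "k = Suc (degree (poly_in_0 (to_poly u)))"
  obtain v where "u - v * (gen (e 0) + scalar \<mu>) ^ k \<in> enveloping_ideal scale br"
    using assms by blast
  then have "to_poly u = to_poly v * (Var 0 + Cst \<mu>) ^ k"
    by (simp add: to_poly_mult_x_power flip: to_poly_eq_iff)
  moreover have "poly_in_0 ((Var 0 + Cst \<mu>) ^ k) = [:Cst \<mu>, 1:] ^ k"
  proof (induction k)
    case 0
    then show ?case using poly_in_0_Cst[of "1::'k"] by (simp add: Cst_simps flip: one_pCons)
  qed (simp add: poly_in_0_mult poly_in_0_add poly_in_0_Var poly_in_0_Cst)
  ultimately have eq: "poly_in_0 (to_poly u) = poly_in_0 (to_poly v) * [:Cst \<mu>, 1:] ^ k"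
    by (simp add: poly_in_0_mult)
  have "poly_in_0 (to_poly u) \<noteq> 0"
    using u by (simp add: poly_in_0_eq_0_iff to_poly_eq_0_iff)
  with eq have "degree (poly_in_0 (to_poly u)) = degree (poly_in_0 (to_poly v)) + k"
    by (auto simp: degree_mult_eq degree_power_eq)
  then show False by (simp add: k_def)
qed

text \<open>
  If \<open>e 0\<close> and \<open>e 1\<close> commute, right multiplication by \<open>e 1\<close> acts on \<open>U / U x\<close>. It is injective
  there: on the polynomial side, passing to \<open>U / U x\<close> is the substitution of \<open>- \<mu>\<close> for the variable
  \<open>0\<close>, and right multiplication by \<open>e 1\<close> is the multiplication by the variable \<open>1\<close>.
\<close>

lemma right_cancel_e_1:
  assumes "lam = 0" and "u * gen (e 1) - h * (gen (e 0) + scalar \<mu>) \<in> enveloping_ideal scale br"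
  shows "\<exists>q. u - q * (gen (e 0) + scalar \<mu>) \<in> enveloping_ideal scale br"
proof -
  have "subst0 (Cst (- \<mu>)) (to_poly u) = 0"
    using subst0_to_poly_eq_0[of u 1 h \<mu>] assms by simp
  then have "Var 0 - Cst (- \<mu>) dvd to_poly u"
    using minus_subst0_dvd[of "Cst (- \<mu>)" "to_poly u"] by simp
  then obtain t where t: "to_poly u = t * (Var 0 + Cst \<mu>)"
    unfolding dvd_def by (auto simp: Cst_simps(5) mult.commute)
  have "from_poly (to_poly u) = from_poly t * (gen (e 0) + scalar \<mu>)"
    unfolding t by (simp add: distrib_left from_poly_add from_poly_mult_Var_0 mult.commute[of t "Cst \<mu>"]
        from_poly_Cst scalar_mult_commute)
  then show ?thesis using from_poly_to_poly[of u] by metis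
qed

text \<open>
  Here \<open>y\<close> is an element with \<open>[y, e 0] = e 1\<close> and \<open>u\<close> commutes with \<open>y\<close>. If \<open>u = v x\<^sup>k\<close> with
  \<open>k > 0\<close>, then \<open>0 = [y, u] = [y, v] x\<^sup>k + k v e\<^sub>1 x\<^sup>k\<^sup>-\<^sup>1\<close>, so \<open>k v e\<^sub>1 \<in> U x\<close>, whence \<open>v \<in> U x\<close>. Thus a
  right multiple of \<open>x\<close> that commutes with \<open>y\<close> is a right multiple of every power of \<open>x\<close>.
\<close>

lemma commuting_right_multiple:
  assumes "lam = 0" and y: "br y (e 0) = e 1"
    and uy: "inner y u \<in> enveloping_ideal scale br"
    and ux: "u - h * (gen (e 0) + scalar \<mu>) \<in> enveloping_ideal scale br"
  shows "u \<in> enveloping_ideal scale br"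
proof (rule right_multiples_of_all_powers)
  define x where "x = gen (e 0) + scalar \<mu>"
  have inner_x: "inner y x - gen (e 1) \<in> enveloping_ideal scale br"
    using gen_br_ideal[of y "e 0"] y
    by (simp add: inner_def x_def distrib_left distrib_right scalar_mult_commute)
  have comm: "x * gen (e 1) - gen (e 1) * x \<in> enveloping_ideal scale br"
  proof -
    have "gen (e 0) * gen (e 1) - gen (e 1) * gen (e 0) - gen 0 + gen 0 \<in> enveloping_ideal scale br"
      using gen_br_ideal[of "e 0" "e 1"] br_01 \<open>lam = 0\<close> by (intro ideal_add gen_zero_ideal) simp
    then show ?thesis
      by (simp add: x_def distrib_left distrib_right scalar_mult_commute)
  qed
  have inner_power: "inner y (x ^ Suc k) - of_nat (Suc k) * (gen (e 1) * x ^ k) \<in> enveloping_ideal scale br"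
    for k
  proof (induction k)
    case 0
    then show ?case using inner_x by simp
  next
    case (Suc k)
    have "(inner y x - gen (e 1)) * x ^ Suc k
        + x * (inner y (x ^ Suc k) - of_nat (Suc k) * (gen (e 1) * x ^ k))
        + of_nat (Suc k) * ((x * gen (e 1) - gen (e 1) * x) * x ^ k) \<in> enveloping_ideal scale br"
      by (intro ideal_add ideal_mult_left ideal_mult_right inner_x Suc comm)
    also have "x * (of_nat (Suc k) * (gen (e 1) * x ^ k)) = of_nat (Suc k) * (x * gen (e 1) * x ^ k)"
      by (simp only: of_nat_left_commute mult.assoc)
    then have "(inner y x - gen (e 1)) * x ^ Suc k
        + x * (inner y (x ^ Suc k) - of_nat (Suc k) * (gen (e 1) * x ^ k))
        + of_nat (Suc k) * ((x * gen (e 1) - gen (e 1) * x) * x ^ k)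
      = inner y (x ^ Suc (Suc k)) - of_nat (Suc (Suc k)) * (gen (e 1) * x ^ Suc k)"
      unfolding power_Suc[of x "Suc k"] inner_mult[of y x "x ^ Suc k"]
      by (simp add: left_diff_distrib right_diff_distrib mult.assoc distrib_right)
    finally show ?case .
  qed
  have step: "\<exists>q. v - q * x \<in> enveloping_ideal scale br"
    if v: "u - v * x ^ Suc k \<in> enveloping_ideal scale br" for v k
  proof -
    let ?c = "of_nat (Suc k) :: 'g list \<Rightarrow>\<^sub>0 'k"
    have "inner y (v * x ^ Suc k) \<in> enveloping_ideal scale br"
      using ideal_diff[OF uy inner_ideal[OF v, of y]] by (simp add: inner_def algebra_simps)
    then have "inner y (v * x ^ Suc k) - v * (inner y (x ^ Suc k) - ?c * (gen (e 1) * x ^ k))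
        \<in> enveloping_ideal scale br"
      by (intro ideal_diff ideal_mult_left inner_power)
    also have "inner y (v * x ^ Suc k) - v * (inner y (x ^ Suc k) - ?c * (gen (e 1) * x ^ k))
      = (?c * v * gen (e 1) - (- inner y v) * x) * x ^ k"
    proof -
      have "v * (?c * (gen (e 1) * x ^ k)) = ?c * v * gen (e 1) * x ^ k"
        by (simp only: of_nat_left_commute mult.assoc)
      then show ?thesis
        unfolding inner_mult by (simp add: left_diff_distrib right_diff_distrib mult.assoc distrib_right)
    qed
    finally have "?c * v * gen (e 1) - (- inner y v) * x \<in> enveloping_ideal scale br"
      unfolding x_def by (rule right_cancel_x_power)
    then obtain q where q: "?c * v - q * x \<in> enveloping_ideal scale br"
      using right_cancel_e_1[OF \<open>lam = 0\<close>] unfolding x_def by blast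
    have "scalar (inverse (of_nat (Suc k))) * ?c = (1 :: 'g list \<Rightarrow>\<^sub>0 'k)"
    proof -
      have "?c = scalar (of_nat (Suc k))"
        by (simp only: scalar_def single_of_nat flip: zero_list_def)
      then show ?thesis
        by (simp add: scalar_simps(2) del: of_nat_Suc flip: scalar_simps(4))
    qed
    then have "v - scalar (inverse (of_nat (Suc k))) * q * x
      = scalar (inverse (of_nat (Suc k))) * (?c * v - q * x)"
      by (simp add: right_diff_distrib del: of_nat_Suc flip: mult.assoc)
    then show ?thesis using ideal_mult_left[OF q] by metis
  qed
  show "\<exists>v. u - v * (gen (e 0) + scalar \<mu>) ^ k \<in> enveloping_ideal scale br" for k
    unfolding x_def[symmetric]
  proof (induction k)
    case 0
    show ?case by (rule exI[of _ u]) (simp add: ideal_zero)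
  next
    case (Suc k)
    then obtain v where v: "u - v * x ^ k \<in> enveloping_ideal scale br" by blast
    obtain q where q: "v - q * x \<in> enveloping_ideal scale br"
    proof (cases k)
      case 0
      then show ?thesis
        using that[of h] ideal_add[OF ideal_minus[OF v] ux] by (simp add: x_def)
    next
      case (Suc l)
      then show ?thesis using that step v by blast
    qed
    have "(u - v * x ^ k) + (v - q * x) * x ^ k \<in> enveloping_ideal scale br"
      by (intro ideal_add ideal_mult_right v q)
    then have "u - q * x ^ Suc k \<in> enveloping_ideal scale br"
      by (simp add: left_diff_distrib mult.assoc)
    then show ?case by blast
  qed
qed

text \<open>
  The annihilator of \<open>U / U x\<close> is stable under \<open>[y, \<cdot>]\<close>, so if it is nonzero, it contains a nonzero
  element that commutes with \<open>y\<close>. Like every element of the annihilator it is a right multiple of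
  \<open>x\<close>, which contradicts the previous lemma.
\<close>

theorem faithful_commuting:
  assumes "lam = 0" and y: "br y (e 0) = e 1" and nil: "ad_nilpotent br y"
    and ann: "\<And>v. \<exists>h. u * v - h * (gen (e 0) + scalar \<mu>) \<in> enveloping_ideal scale br"
  shows "u \<in> enveloping_ideal scale br"
proof (rule ccontr)
  assume "u \<notin> enveloping_ideal scale br"
  with nil obtain m where m: "(inner y ^^ m) u \<notin> enveloping_ideal scale br"
    "inner y ((inner y ^^ m) u) \<in> enveloping_ideal scale br"
    by (rule inner_kernel_element)
  have ann_m: "\<exists>h. (inner y ^^ m) u * v - h * (gen (e 0) + scalar \<mu>) \<in> enveloping_ideal scale br" for m v
  proof (induction m arbitrary: v)
    case 0
    then show ?case using ann by simp
  next
    case (Suc m)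
    let ?w = "(inner y ^^ m) u"
    obtain h h' where h: "?w * v - h * (gen (e 0) + scalar \<mu>) \<in> enveloping_ideal scale br"
      "?w * (gen y * v) - h' * (gen (e 0) + scalar \<mu>) \<in> enveloping_ideal scale br"
      using Suc by blast
    have "gen y * (?w * v - h * (gen (e 0) + scalar \<mu>)) - (?w * (gen y * v) - h' * (gen (e 0) + scalar \<mu>))
      \<in> enveloping_ideal scale br"
      by (intro ideal_diff ideal_mult_left h)
    then have "(inner y ^^ Suc m) u * v - (gen y * h - h') * (gen (e 0) + scalar \<mu>) \<in> enveloping_ideal scale br"
      by (simp add: inner_def algebra_simps)
    then show ?case by blast
  qed
  from ann_m[of m 1] obtain h where
    "(inner y ^^ m) u - h * (gen (e 0) + scalar \<mu>) \<in> enveloping_ideal scale br" by auto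
  then show False using commuting_right_multiple[OF \<open>lam = 0\<close> y m(2)] m(1) by blast
qed

end

section \<open>Nonzero eigenvalues\<close>

locale linear_endomorphism = vector_space scale
  for scale :: "'k::field \<Rightarrow> 'v::ab_group_add \<Rightarrow> 'v" +
  fixes T :: "'v \<Rightarrow> 'v"
  assumes T_add: "T (v + w) = T v + T w" and T_scale: "T (scale c v) = scale c (T v)"
begin

lemma T_zero: "T 0 = 0"
  using T_add[of 0 0] by simp

lemma T_pow_zero: "(T ^^ k) 0 = 0"
  by (induction k) (simp_all add: T_zero)

definition apply_poly :: "'k poly \<Rightarrow> 'v \<Rightarrow> 'v"
  where "apply_poly p v = fold_coeffs (\<lambda>a w. scale a v + T w) p 0"

lemma apply_poly_0: "apply_poly 0 v = 0"
  by (simp add: apply_poly_def)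

lemma apply_poly_pCons: "apply_poly (pCons a p) v = scale a v + T (apply_poly p v)"
  by (cases "p = 0 \<and> a = 0") (auto simp: apply_poly_def T_zero)

lemma apply_poly_add: "apply_poly (p + q) v = apply_poly p v + apply_poly q v"
  by (induction p q rule: poly_induct2)
    (simp_all add: apply_poly_0 apply_poly_pCons T_add scale_left_distrib algebra_simps)

lemma apply_poly_smult: "apply_poly (smult c p) v = scale c (apply_poly p v)"
  by (induction p) (simp_all add: apply_poly_0 apply_poly_pCons T_scale scale_right_distrib)

lemma apply_poly_linear_factor: "apply_poly ([:- c, 1:] * q) v = T (apply_poly q v) - scale c (apply_poly q v)"
proof -
  have "[:- c, 1:] * q = smult (- c) q + pCons 0 q" by simp
  then show ?thesis by (simp only: apply_poly_add apply_poly_smult apply_poly_pCons) simp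
qed

lemma apply_poly_T: "apply_poly p (T v) = T (apply_poly p v)"
  by (induction p) (simp_all add: apply_poly_0 apply_poly_pCons T_zero T_add T_scale)

lemma apply_poly_monom: "apply_poly (Polynomial.monom c i) v = scale c ((T ^^ i) v)"
proof (induction i)
  case 0
  show ?case by (simp add: monom_0 apply_poly_pCons apply_poly_0 T_zero)
next
  case (Suc i)
  then show ?case by (simp add: monom_Suc apply_poly_pCons T_scale)
qed

lemma apply_poly_sum: "apply_poly (sum f A) v = (\<Sum>a\<in>A. apply_poly (f a) v)"
  by (induction A rule: infinite_finite_induct) (simp_all add: apply_poly_0 apply_poly_add)

end

text \<open>
  Split linear factors off \<open>p\<close> one by one. A factor with root \<open>0\<close> is absorbed by replacing \<open>v\<close>
  with \<open>T v\<close>, and the hypothesis on \<open>T ^^ degree p\<close> ensures that this cannot use up \<open>p\<close>.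
\<close>

lemma (in linear_endomorphism) nonzero_eigenvalue_if_annihilated:
  assumes root: "\<And>p. degree (p :: 'k poly) > 0 \<Longrightarrow> \<exists>c. poly p c = 0"
    and "p \<noteq> 0" "apply_poly p v = 0" "(T ^^ degree p) v \<noteq> 0"
  shows "\<exists>c w. c \<noteq> 0 \<and> w \<noteq> 0 \<and> T w = scale c w"
  using assms(2-)
proof (induction "degree p" arbitrary: p v)
  case 0
  then obtain a where "p = [:a:]" "a \<noteq> 0" by (metis degree_eq_zeroE pCons_0_0)
  then show ?case using 0 by (simp add: apply_poly_pCons apply_poly_0 T_zero)
next
  case (Suc d)
  then obtain c where "poly p c = 0" using root[of p] by auto
  then obtain q where p: "p = [:- c, 1:] * q" by (metis poly_eq_0_iff_dvd dvdE)
  then have q: "q \<noteq> 0" using Suc.prems by auto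
  have "degree p = Suc (degree q)" unfolding p using q by (subst degree_mult_eq) auto
  then have d: "d = degree q" using Suc.hyps(2) by simp
  have pow: "(T ^^ degree q) (T v) \<noteq> 0"
    using Suc.prems(3) Suc.hyps(2) d by (simp add: funpow_swap1 flip: Suc.hyps(2))
  have Tw: "T (apply_poly q v) = scale c (apply_poly q v)"
    using Suc.prems(2) by (simp add: p apply_poly_linear_factor del: mult_pCons_left)
  consider "apply_poly q v = 0" | "apply_poly q v \<noteq> 0" "c \<noteq> 0" | "apply_poly q v \<noteq> 0" "c = 0" by blast
  then show ?case
  proof cases
    case 1
    moreover have "(T ^^ degree q) v \<noteq> 0"
      using pow by (auto simp: T_zero simp flip: funpow_swap1)
    ultimately show ?thesis using Suc.hyps(1)[OF d q] by blast
  next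
    case 2
    then show ?thesis using Tw by blast
  next
    case 3
    then have "apply_poly q (T v) = 0" using Tw by (simp add: apply_poly_T)
    then show ?thesis using Suc.hyps(1)[OF d q _ pow] by blast
  qed
qed

lemma nonnilpotent_imp_nonzero_eigenvalue:
  fixes scale :: "'k::alg_closed_field \<Rightarrow> 'v::ab_group_add \<Rightarrow> 'v"
  assumes "finite_dimensional_vector_space scale B"
    and add: "\<And>v w. T (v + w) = T v + T w" and scl: "\<And>c v. T (scale c v) = scale c (T v)"
    and nonnil: "\<not> (\<exists>n. \<forall>y. (T ^^ n) y = 0)"
  shows "\<exists>c w. c \<noteq> 0 \<and> w \<noteq> 0 \<and> T w = scale c w"
proof -
  interpret V: finite_dimensional_vector_space scale B by fact
  interpret E: linear_endomorphism scale T by unfold_locales (rule add scl)+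
  define N where "N = V.dim UNIV"
  obtain y where y: "(T ^^ N) y \<noteq> 0" using nonnil by blast
  \<comment> \<open>The \<open>N + 1\<close> vectors \<open>y, T y, \<dots>, T\<^sup>N y\<close> satisfy a linear relation.\<close>
  have "\<exists>p. p \<noteq> 0 \<and> degree p \<le> N \<and> E.apply_poly p y = 0"
  proof (cases "inj_on (\<lambda>i. (T ^^ i) y) {..N}")
    case False
    then obtain i j where ij: "i \<le> N" "j \<le> N" "i \<noteq> j" "(T ^^ i) y = (T ^^ j) y"
      by (auto simp: inj_on_def)
    define p where "p = Polynomial.monom 1 i + Polynomial.monom (- 1 :: 'k) j"
    have "coeff p i = 1" using ij by (simp add: p_def)
    then have "p \<noteq> 0" by auto
    moreover have "degree p \<le> N"
      unfolding p_def using ij by (intro degree_add_le order_trans[OF degree_monom_le])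
    moreover have "E.apply_poly p y = 0"
      by (simp add: p_def E.apply_poly_add E.apply_poly_monom ij(4))
    ultimately show ?thesis by blast
  next
    case True
    let ?S = "(\<lambda>i. (T ^^ i) y) ` {..N}"
    have "card ?S = Suc N" using True by (simp add: card_image)
    then have "V.dependent ?S"
      using V.independent_card_le_dim[of ?S UNIV] by (auto simp: N_def)
    then obtain u where u: "\<exists>v\<in>?S. u v \<noteq> 0" "(\<Sum>v\<in>?S. scale (u v) v) = 0"
      by (subst (asm) V.dependent_finite) auto
    define p where "p = (\<Sum>i\<le>N. Polynomial.monom (u ((T ^^ i) y)) i)"
    from u(1) obtain i where "i \<le> N" "u ((T ^^ i) y) \<noteq> 0" by auto
    then have "coeff p i \<noteq> 0" by (simp add: p_def coeff_sum)
    then have "p \<noteq> 0" by auto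
    moreover have "degree p \<le> N"
      unfolding p_def by (intro degree_sum_le) (auto intro: order_trans[OF degree_monom_le])
    moreover have "E.apply_poly p y = 0"
      using u(2) by (simp add: p_def E.apply_poly_sum E.apply_poly_monom sum.reindex[OF True])
    ultimately show ?thesis by blast
  qed
  then obtain p where p: "p \<noteq> 0" "degree p \<le> N" "E.apply_poly p y = 0" by blast
  have "(T ^^ N) y = (T ^^ (N - degree p)) ((T ^^ degree p) y)"
    using p(2) by (simp flip: comp_apply[of "T ^^ (N - degree p)"] funpow_add)
  then have "(T ^^ degree p) y \<noteq> 0" using y by (auto simp: E.T_pow_zero)
  then show ?thesis
    using E.nonzero_eigenvalue_if_annihilated[of p y] alg_closed_imp_poly_has_root p by blast
qed

section \<open>Faithfulness of the induced module\<close>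

lemma (in lie_algebra) lie_basis_exists:
  assumes "finite_dimensional_vector_space scale B" and ind: "independent {x, y}" and "x \<noteq> y"
  obtains n e coord where "lie_basis scale br n e coord" "1 < n" "e 0 = x" "e 1 = y"
proof -
  interpret V: finite_dimensional_vector_space scale B by fact
  define C where "C = extend_basis {x, y}"
  have C: "independent C" "span C = UNIV" "{x, y} \<subseteq> C"
    using independent_extend_basis[OF ind] span_extend_basis[OF ind] extend_basis_superset[OF ind]
    by (simp_all add: C_def)
  then have "finite C" by (simp add: V.finiteI_independent)
  then obtain zs where zs: "set zs = C - {x, y}" "distinct zs"
    using finite_distinct_list[of "C - {x, y}"] by auto
  define bs where "bs = x # y # zs"
  have bs: "set bs = C" "distinct bs" using zs C(3) \<open>x \<noteq> y\<close> by (auto simp: bs_def)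
  define e where "e i = bs ! i" for i
  define coord where "coord v i = representation C v (e i)" for v i
  have e_bij: "bij_betw e {..<length bs} C"
    using bij_betw_nth[OF bs(2) refl bs(1)[symmetric]]
    by (simp add: e_def[abs_def])
  have "lie_basis scale br (length bs) e coord"
  proof
    show "coord (v + w) i = coord v i + coord w i" for v w i
      by (simp add: coord_def representation_add[OF C(1)] C(2))
    show "coord (scale c v) i = c * coord v i" for c v i
      by (simp add: coord_def representation_scale[OF C(1)] C(2))
    show "(\<Sum>k<length bs. scale (coord v k) (e k)) = v" for v
      unfolding coord_def sum.reindex_bij_betw[OF e_bij, of "\<lambda>b. scale (representation C v b) b"]
      using sum_representation_eq[OF C(1) _ \<open>finite C\<close> order_refl, of v] C(2) by simp
    show "coord (e i) k = (if k = i then 1 else 0)" if "i < length bs" "k < length bs" for i k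
    proof -
      have "e i \<in> C" using e_bij that by (auto simp: bij_betw_def)
      moreover have "e k = e i \<longleftrightarrow> k = i"
        using e_bij that by (auto simp: bij_betw_def inj_on_def)
      ultimately show ?thesis by (auto simp: coord_def representation_basis[OF C(1)])
    qed
  qed
  moreover have "1 < length bs" "e 0 = x" "e 1 = y" by (simp_all add: e_def bs_def)
  ultimately show ?thesis using that by blast
qed

lemma (in lie_algebra) lie_nilpotent_imp_ad_nilpotent:
  assumes "lie_nilpotent scale br"
  shows "ad_nilpotent br x"
proof -
  have "(br x ^^ m) y \<in> lower_central_series scale br m" for m y
    by (induction m) (auto intro!: span_base)
  then show ?thesis using assms by (auto simp: lie_nilpotent_def ad_nilpotent_def)
qed

lemma (in lie_algebra) independent_pairI:
  assumes "y \<noteq> 0" and "\<And>c. x \<noteq> scale c y"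
  shows "independent {x, y}" and "x \<noteq> y"
proof -
  show "x \<noteq> y" using assms(2)[of 1] by simp
  have "x \<notin> span {y}" using assms(2) by (auto simp: span_singleton)
  then show "independent {x, y}"
    using assms(1) \<open>x \<noteq> y\<close> by (simp add: independent_insert)
qed

text \<open>
  If \<open>\<gg>\<close> is not nilpotent, \<open>ad x\<close> has an eigenvector \<open>y\<close> with nonzero eigenvalue, and \<open>(x, y)\<close> is
  extended to a basis. Otherwise \<open>ad x\<close> is nilpotent but not zero, which gives \<open>y\<close> with
  \<open>w = [y, x] \<noteq> 0\<close> and \<open>[x, w] = 0\<close>, and \<open>(x, w)\<close> is extended to a basis.
\<close>

theorem quotient_of_enveloping_algebra_faithful:
  fixes scale :: "'k::{alg_closed_field, field_char_0} \<Rightarrow> 'g::ab_group_add \<Rightarrow> 'g"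
  assumes "lie_algebra scale br" and fin: "finite_dimensional_vector_space scale B"
    and x: "x \<in> X_prime scale br"
    and ann: "\<And>v. \<exists>h. u * v - h * (gen x + scalar \<mu>) \<in> enveloping_ideal scale br"
  shows "u \<in> enveloping_ideal scale br"
proof -
  interpret lie_algebra scale br by fact
  show ?thesis
  proof (cases "lie_nilpotent scale br")
    case False
    with x have "\<not> ad_nilpotent br x" by (simp add: X_prime_def)
    then have nonnil: "\<not> (\<exists>n. \<forall>y. (br x ^^ n) y = 0)" unfolding ad_nilpotent_def .
    obtain c y where y: "c \<noteq> 0" "y \<noteq> 0" "br x y = scale c y"
      using nonnilpotent_imp_nonzero_eigenvalue[OF fin, of "br x", OF br_add_right br_scale_right nonnil]
      by (elim exE conjE)
    have "x \<noteq> scale d y" for d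
    proof
      assume "x = scale d y"
      then have "br x y = 0" by (simp add: br_scale_left br_self)
      then show False using y by simp
    qed
    note ind = independent_pairI[OF y(2) this]
    obtain n e coord where b: "lie_basis scale br n e coord" "1 < n" "e 0 = x" "e 1 = y"
      using lie_basis_exists[OF fin ind] .
    then interpret lie_basis_eigen scale br n e coord c
      using y by (simp add: lie_basis_eigen_def lie_basis_eigen_axioms_def)
    show ?thesis by (rule faithful_eigen[OF y(1), of u \<mu>]) (unfold b(3), rule ann)
  next
    case True
    then have nil: "ad_nilpotent br z" for z by (rule lie_nilpotent_imp_ad_nilpotent)
    from x True have "x \<notin> lie_center br" by (simp add: X_prime_def)
    then obtain z where z: "br x z \<noteq> 0" unfolding lie_center_def by blast
    define m where "m = (LEAST m. (br x ^^ m) z = 0)"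
    from nil[of x] obtain l where "(br x ^^ l) z = 0" unfolding ad_nilpotent_def by blast
    then have m0: "(br x ^^ m) z = 0" unfolding m_def by (rule LeastI)
    have less: "(br x ^^ k) z \<noteq> 0" if "k < m" for k
      using not_less_Least[OF that[unfolded m_def]] .
    have "z \<noteq> 0" using z by (auto simp: br_zero_right)
    then have "m \<noteq> 0" using m0 by (cases m) simp_all
    moreover have "m \<noteq> 1" using m0 z by (intro notI) simp
    ultimately obtain k where k: "m = Suc (Suc k)" by (metis One_nat_def not0_implies_Suc)
    \<comment> \<open>The last two nonzero vectors of the sequence \<open>z, [x, z], [x, [x, z]], \<dots>\<close> are \<open>- y\<close> and \<open>w\<close>.\<close>
    define y where "y = - (br x ^^ k) z"
    define w where "w = br y x"
    have w_eq: "w = br x ((br x ^^ k) z)"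
      unfolding w_def y_def br_minus_left by (rule br_antisym[symmetric])
    have "w \<noteq> 0" "br x w = 0"
      using less[of "Suc k"] m0 by (simp_all add: w_eq k)
    \<comment> \<open>If \<open>x\<close> were a multiple of \<open>w = [y, x]\<close>, it would be an eigenvector of the nilpotent \<open>ad y\<close>.\<close>
    have "x \<noteq> scale d w" for d
    proof
      assume xd: "x = scale d w"
      then have "d \<noteq> 0" using z by (auto simp: br_zero_left)
      have "(br y ^^ l) x \<noteq> 0" for l
      proof (induction l)
        case 0
        then show ?case using z by (auto simp: br_zero_left)
      next
        case (Suc l)
        have "scale d (br y x) = x" using xd by (simp add: w_def)
        then have "scale d ((br y ^^ Suc l) x) = (br y ^^ l) x"
        proof (induction l)
          case (Suc l)
          then show ?case by (simp flip: br_scale_right)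
        qed simp
        then show ?case using Suc by auto
      qed
      then show False using nil[of y] by (auto simp: ad_nilpotent_def)
    qed
    note ind = independent_pairI[OF \<open>w \<noteq> 0\<close> this]
    obtain n e coord where b: "lie_basis scale br n e coord" "1 < n" "e 0 = x" "e 1 = w"
      using lie_basis_exists[OF fin ind] .
    then interpret lie_basis_eigen scale br n e coord 0
      using \<open>br x w = 0\<close> by (simp add: lie_basis_eigen_def lie_basis_eigen_axioms_def)
    show ?thesis
    proof (rule faithful_commuting[OF refl _ nil])
      show "br y (e 0) = e 1" unfolding b(3,4) w_def ..
      show "\<exists>h. u * v - h * (gen (e 0) + scalar \<mu>) \<in> enveloping_ideal scale br" for v
        unfolding b(3) by (rule ann)
    qed
  qed
qed

section \<open>From the enveloping algebra to the Rees ring\<close>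

context lie_algebra
begin

lemma one_in_std_filtration: "env_proj scale br 1 \<in> std_filtration scale br m"
proof (induction m)
  case 0
  show ?case by (auto simp: env_scalar_def scalar_simps intro!: image_eqI[of _ _ 1])
next
  case (Suc m)
  have "env_proj scale br 1 = env_proj scale br (gen 0 + scalar 1)"
    unfolding env_proj_eq_iff using ideal_minus[OF gen_zero_ideal] by (simp add: scalar_simps)
  then have "env_proj scale br 1 \<in> std_filtration scale br 1"
    by (auto simp: plus_scalars_UNIV)
  from std_filtration_mult[OF this Suc] show ?case by (simp add: env_proj_mult)
qed

lemma std_filtration_mono:
  assumes "u \<in> std_filtration scale br m" "m \<le> m'"
  shows "u \<in> std_filtration scale br m'"
proof -
  obtain p where "u = env_proj scale br p"
    using assms(1) std_filtration_subset carrier_enveloping_algebra by blast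
  then show ?thesis
    using std_filtration_mult[OF assms(1) one_in_std_filtration[of "m' - m"]] assms(2)
    by (simp add: env_proj_mult)
qed

lemma std_filtration_exhaustive: "\<exists>m. env_proj scale br v \<in> std_filtration scale br m"
proof (induction v rule: poly_mapping_keys_induct)
  case zero
  show ?case using std_filtration_zero unfolding env_proj_zero by blast
next
  case (single w c)
  have "env_proj scale br (Poly_Mapping.single w c) \<in> std_filtration scale br (length w)"
  proof (induction w)
    case Nil
    show ?case by (simp add: env_scalar_def scalar_def)
  next
    case (Cons v w)
    have "env_proj scale br (gen v + scalar 0) \<in> std_filtration scale br 1"
      by (auto simp: plus_scalars_UNIV)
    from std_filtration_mult[OF this Cons] show ?case
      by (simp add: env_proj_mult scalar_simps gen_def mult_single plus_list_def)
  qed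
  then show ?case by blast
next
  case (add q r)
  then obtain k m where "env_proj scale br q \<in> std_filtration scale br k"
    "env_proj scale br r \<in> std_filtration scale br m" by blast
  then have "env_proj scale br q \<in> std_filtration scale br (max k m)"
    "env_proj scale br r \<in> std_filtration scale br (max k m)"
    by (auto intro: std_filtration_mono)
  from std_filtration_add[OF this] show ?case by (auto simp: env_proj_add)
qed

end

lemma (in UP_ring) coeff_mult_monom:
  assumes p: "p \<in> carrier P" and r: "r \<in> carrier R"
  shows "up_ring.coeff P (p \<otimes>\<^bsub>P\<^esub> up_ring.monom P r m) (n + m) = up_ring.coeff P p n \<otimes> r"
proof -
  have "up_ring.coeff P (p \<otimes>\<^bsub>P\<^esub> up_ring.monom P r m) (n + m)
    = (\<Oplus>i\<in>{..n + m}. up_ring.coeff P p i \<otimes> up_ring.coeff P (up_ring.monom P r m) (n + m - i))"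
    using p r by simp
  also have "\<dots> = (\<Oplus>i\<in>{..n + m}. if n = i then up_ring.coeff P p i \<otimes> r else \<zero>)"
    using p r by (intro R.finsum_cong') (auto simp: R.finsum_cong')
  also have "\<dots> = up_ring.coeff P p n \<otimes> r"
    using p r by (subst R.finsum_singleton) auto
  finally show ?thesis .
qed

text \<open>
  The scalar multiplication of the quotient is a union over representatives, so it is enough that
  \<open>r c\<close> lies in one of the cosets forming it.
\<close>

lemma (in ring) quotient_annihilates:
  assumes J: "additive_subgroup J R"
    and r: "r \<in> left_annihilator R (quotient_left_module R J)" and c: "c \<in> carrier R"
  shows "r \<otimes> c \<in> J"
proof -
  interpret J: additive_subgroup J R by fact
  let ?M = "quotient_left_module R J"
  have rc: "r \<otimes> c \<in> carrier R" using r c by (auto simp: left_annihilator_def)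
  have self: "a \<in> J +> a" if "a \<in> carrier R" for a
    using that J.zero_closed by (force simp: a_r_coset_def')
  have "J +> c \<in> carrier ?M"
    using c by (auto simp: quotient_left_module_def A_RCOSETS_def')
  then have "r \<odot>\<^bsub>?M\<^esub> (J +> c) = J"
    using r by (auto simp: left_annihilator_def quotient_left_module_def)
  moreover have "J +> (r \<otimes> c) \<subseteq> r \<odot>\<^bsub>?M\<^esub> (J +> c)"
    using self[OF c] by (auto simp: quotient_left_module_def)
  ultimately show ?thesis using self[OF rc] by blast
qed

lemma (in left_module) zero_in_left_annihilator: "\<zero> \<in> left_annihilator R M"
proof -
  have "\<zero> \<odot>\<^bsub>M\<^esub> m = \<zero>\<^bsub>M\<^esub>" if m: "m \<in> carrier M" for m
  proof -
    have "\<zero> \<odot>\<^bsub>M\<^esub> m \<oplus>\<^bsub>M\<^esub> \<zero> \<odot>\<^bsub>M\<^esub> m = \<zero> \<odot>\<^bsub>M\<^esub> m"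
      using smult_l_distr[of \<zero> \<zero> m] m by simp
    then show ?thesis using smult_closed[OF R.zero_closed m] by simp
  qed
  then show ?thesis by (simp add: left_annihilator_def)
qed

theorem corollary3p2:
  fixes scale :: "'k::{alg_closed_field, field_char_0} \<Rightarrow> 'g::ab_group_add \<Rightarrow> 'g"
    and br :: "'g \<Rightarrow> 'g \<Rightarrow> 'g"
    and L :: "nat \<Rightarrow> ('g list \<Rightarrow>\<^sub>0 'k) set"
  defines "H \<equiv> homogenized_enveloping_algebra scale br"
  assumes "lie_algebra scale br"
    and "\<exists>B. finite_dimensional_vector_space scale B"
    and "\<not> lie_abelian br"
    and "L \<in> X_tilde scale br"
  shows "faithful_left_module H (quotient_left_module H (carrier H #>\<^bsub>H\<^esub> L))"
proof -
  interpret lie_algebra scale br by fact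
  obtain B where fin: "finite_dimensional_vector_space scale B" using assms(3) by blast
  define U where "U = enveloping_algebra scale br"
  interpret U: ring U unfolding U_def by (rule ring_enveloping_algebra)
  interpret P: UP_ring U "UP U" by unfold_locales simp
  interpret H: ring H unfolding H_def by (rule ring_homogenized)
  have carrier_H: "carrier H = {p \<in> carrier (UP U). \<forall>n. up_ring.coeff (UP U) p n \<in> std_filtration scale br n}"
    and mult_H: "p \<otimes>\<^bsub>H\<^esub> q = p \<otimes>\<^bsub>UP U\<^esub> q" and zero_H: "\<zero>\<^bsub>H\<^esub> = \<zero>\<^bsub>UP U\<^esub>" for p q
    by (simp_all add: H_def homogenized_enveloping_algebra_def U_def)
  have L: "L \<in> carrier H"
    using X_tilde_subset[OF assms(2)] assms(5) unfolding H_def by blast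
  obtain x \<mu> where x: "x \<in> X_prime scale br"
    and L_eq: "L = up_ring.monom (UP U) (env_proj scale br (gen x + scalar \<mu>)) 1"
    using assms(5) by (auto simp: X_tilde_def plus_scalars_def U_def env_embed_def env_scalar_def env_proj_add)
  let ?J = "carrier H #>\<^bsub>H\<^esub> L"
  let ?x = "gen x + scalar \<mu>"
  have J: "additive_subgroup ?J H" by (rule H.additive_subgroup_left_multiples[OF L])
  interpret M: left_module H "quotient_left_module H ?J"
    by (rule H.left_module_quotient_principal[OF L])
  have closed: "env_proj scale br p \<in> carrier U" for p
    by (simp add: U_def carrier_enveloping_algebra)
  have "r = \<zero>\<^bsub>H\<^esub>" if r: "r \<in> left_annihilator H (quotient_left_module H ?J)" for r
  proof -
    have rH: "r \<in> carrier H" using r by (simp add: left_annihilator_def)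
    then have rP: "r \<in> carrier (UP U)" by (simp add: carrier_H)
    have "up_ring.coeff (UP U) r n = \<zero>\<^bsub>U\<^esub>" for n
    proof -
      have "up_ring.coeff (UP U) r n \<in> range (env_proj scale br)"
        using P.coeff_closed[OF rP] by (simp add: U_def carrier_enveloping_algebra)
      then obtain u where u: "up_ring.coeff (UP U) r n = env_proj scale br u" by blast
      have "\<exists>h. u * v - h * ?x \<in> enveloping_ideal scale br" for v
      proof -
        obtain m where m: "env_proj scale br v \<in> std_filtration scale br m"
          using std_filtration_exhaustive by blast
        \<comment> \<open>Compare the coefficients of \<open>z\<^sup>n\<^sup>+\<^sup>m\<close> in \<open>r (v z\<^sup>m) \<in> H L\<close>.\<close>
        define c where "c = up_ring.monom (UP U) (env_proj scale br v) m"
        have cH: "c \<in> carrier H"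
          using m closed std_filtration_zero[folded U_def] by (auto simp: carrier_H c_def)
        have "r \<otimes>\<^bsub>H\<^esub> c \<in> ?J" by (rule H.quotient_annihilates[OF J r cH])
        then obtain h where h: "h \<in> carrier H" "r \<otimes>\<^bsub>UP U\<^esub> c = h \<otimes>\<^bsub>UP U\<^esub> L"
          by (auto simp: r_coset_def mult_H)
        then have hP: "h \<in> carrier (UP U)" by (simp add: carrier_H)
        have uv: "env_proj scale br (u * v) = up_ring.coeff (UP U) (h \<otimes>\<^bsub>UP U\<^esub> L) (n + m)"
          using P.coeff_mult_monom[OF rP closed[of v], of m n] h(2) u
          by (simp add: c_def U_def env_proj_mult)
        have "\<exists>q. up_ring.coeff (UP U) (h \<otimes>\<^bsub>UP U\<^esub> L) (n + m) = env_proj scale br (q * ?x)"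
        proof (cases "n + m")
          \<comment> \<open>All elements of \<open>H L\<close> have constant coefficient zero.\<close>
          case 0
          have "up_ring.coeff (UP U) L 0 = \<zero>\<^bsub>U\<^esub>"
            using closed by (simp add: L_eq)
          then have "up_ring.coeff (UP U) (h \<otimes>\<^bsub>UP U\<^esub> L) 0 = \<zero>\<^bsub>U\<^esub>"
            using hP L by (simp add: carrier_H)
          then show ?thesis
            using 0 by (intro exI[of _ 0]) (simp add: U_def env_proj_zero)
        next
          case (Suc k)
          have "up_ring.coeff (UP U) h k \<in> range (env_proj scale br)"
            using P.coeff_closed[OF hP] by (simp add: U_def carrier_enveloping_algebra)
          then obtain q where "up_ring.coeff (UP U) h k = env_proj scale br q" by blast
          then have "up_ring.coeff (UP U) (h \<otimes>\<^bsub>UP U\<^esub> L) (k + 1) = env_proj scale br (q * ?x)"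
            unfolding L_eq P.coeff_mult_monom[OF hP closed] by (simp add: U_def env_proj_mult)
          then show ?thesis using Suc by auto
        qed
        then show ?thesis unfolding uv[symmetric] env_proj_eq_iff .
      qed
      then have "u \<in> enveloping_ideal scale br"
        by (rule quotient_of_enveloping_algebra_faithful[OF assms(2) fin x])
      then have "env_proj scale br u = env_proj scale br 0" by (simp add: env_proj_eq_iff)
      also have "\<dots> = \<zero>\<^bsub>U\<^esub>" by (simp add: U_def env_proj_zero)
      finally show ?thesis using u by simp
    qed
    then show ?thesis
      unfolding zero_H by (intro P.up_eqI[OF _ rP P.UP_zero_closed]) simp
  qed
  then show ?thesis
    using M.left_module_axioms M.zero_in_left_annihilator
    unfolding faithful_left_module_def by blast
qed

end
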